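(* Let $U$ and $V$ be locally finite persistence modules indexed by $\mathbb{R}$. For every $\varepsilon\ge0$, there exists an $\varepsilon$-interleaving between $U$ and $V$ if and only if there exists an $\varepsilon$-matching between the barcodes $\mathrm{bar}(U)$ and $\mathrm{bar}(V)$. This implies $$d_I(U,V)=d_B(\mathrm{bar}(U),\mathrm{bar}(V)).$$
   Context: Fix a field $F$; all vector spaces are over $F$. A persistence module $V$ indexed by $\mathbb{R}$ is a functor from the poset $\mathbb{R}$ to vector spaces, with spaces $V_t$ and structure maps $V_{s\le t}$; morphisms are natural transformations; direct sums are pointwise. Decorated reals: $\mathbb{R}\times\{-,+\}$ with lexicographic order, $-<+$; write $t^\pm$, and add bottom and top elements $-\infty,\infty$. For such $b\le d$, $\lceil b,d\rfloor\subseteq\mathbb{R}$ is the interval with these endpoints: a lower endpoint $s^-$ is closed, $s^+$ is open; an upper endpoint $t^+$ is closed, $t^-$ is open; $\pm\infty$ are unbounded ends. Put $s^\pm+t=(s+t)^\pm$ and $\pm\infty+t=\pm\infty$. For a nonempty interval $L$, the interval module $\mathbb{I}(L)$ is $F$ at $t\in L$ and $0$ elsewhere, with identity structure maps inside $L$ and zero maps otherwise. A module is interval decomposable if it is isomorphic to a (possibly infinite) direct sum $\bigoplus_{i\in I}\mathbb{I}(L_i)$; the multiset $\{L_i\}_{i\in I}$ is then unique and is the barcode $\mathrm{bar}(V)$, with members called bars. An interval-decomposable module $V\cong\bigoplus_{i\in I}\mathbb{I}(L_i)$ indexed by $\mathbb{R}$ is locally finite if each $t\in\mathbb{R}$ has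 a neighborhood that intersects only finitely many of the $L_i$ (finitely many indices $i$). $V_{\_+\varepsilon}$ is the module with $t$ component $V_{t+\varepsilon}$ and structure maps $V_{s+\varepsilon\le t+\varepsilon}$. For $\varepsilon\ge0$, an $\varepsilon$-interleaving between $U$ and $V$ is a pair of morphisms $\varphi\colon U\to V_{\_+\varepsilon}$, $\psi\colon V\to U_{\_+\varepsilon}$ with $\psi_{t+\varepsilon}\circ\varphi_t=U_{t\le t+2\varepsilon}$ and $\varphi_{t+\varepsilon}\circ\psi_t=V_{t\le t+2\varepsilon}$ for all $t$. $d_I(U,V)=\inf\{\varepsilon>0\mid$ there exists an $\varepsilon$-interleaving between $U$ and $V\}$. A matching of barcodes $\{\lceil b_i,d_i\rfloor\}_{i\in I}$ and $\{\lceil b'_j,d'_j\rfloor\}_{j\in J}$ is a subset $M\subseteq I\times J$ in which each $i$ and each $j$ occurs at most once. It is an $\varepsilon$-matching if (1) every bar in either barcode that contains a closed interval of length $2\varepsilon$ is matched, and (2) for all $(i,j)\in M$, $\lceil b_i,d_i\rfloor\subseteq\lceil b'_j-\varepsilon,d'_j+\varepsilon\rfloor$ and $\lceil b'_j,d'_j\rfloor\subseteq\lceil b_i-\varepsilon,d_i+\varepsilon\rfloor$. $d_B$ of two barcodes is $\inf\{\varepsilon>0\mid$ there exists an $\varepsilon$-matching between them$\}$. The infimum of the empty set is $\infty$. *)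

theory Defs
  imports Complex_Main "HOL-Library.Function_Algebras" "HOL-Library.Extended_Real"
begin

section \<open>Decorated reals and intervals\<close>

text \<open>Decorated reals with a bottom and a top element: \<open>Minus t\<close> is $t^-$ and \<open>Plus t\<close> is $t^+$.\<close>

datatype decorated = Neg_Inf | Minus real | Plus real | Pos_Inf

fun decorated_le :: "decorated \<Rightarrow> decorated \<Rightarrow> bool" where
  "decorated_le Neg_Inf _ = True"
| "decorated_le _ Pos_Inf = True"
| "decorated_le (Minus s) (Minus t) = (s \<le> t)"
| "decorated_le (Minus s) (Plus t) = (s \<le> t)"
| "decorated_le (Plus s) (Minus t) = (s < t)"
| "decorated_le (Plus s) (Plus t) = (s \<le> t)"
| "decorated_le _ _ = False"

instantiation decorated :: linorder
begin

definition less_eq_decorated :: "decorated \<Rightarrow> decorated \<Rightarrow> bool" where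
  "less_eq_decorated = decorated_le"

definition less_decorated :: "decorated \<Rightarrow> decorated \<Rightarrow> bool" where
  "less_decorated x y \<longleftrightarrow> decorated_le x y \<and> \<not> decorated_le y x"

instance
proof
  fix x y z :: decorated
  show "x \<le> x"
    by (cases x) (simp_all add: less_eq_decorated_def)
  show "(x < y) = (x \<le> y \<and> \<not> y \<le> x)"
    by (simp add: less_eq_decorated_def less_decorated_def)
  show "x \<le> z" if "x \<le> y" "y \<le> z"
    using that by (cases x; cases y; cases z) (simp_all add: less_eq_decorated_def)
  show "x = y" if "x \<le> y" "y \<le> x"
    using that by (cases x; cases y) (simp_all add: less_eq_decorated_def)
  show "x \<le> y \<or> y \<le> x"
    by (cases x; cases y) (auto simp: less_eq_decorated_def)
qed

end

primrec shift :: "decorated \<Rightarrow> real \<Rightarrow> decorated" where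
  "shift Neg_Inf t = Neg_Inf"
| "shift (Minus s) t = Minus (s + t)"
| "shift (Plus s) t = Plus (s + t)"
| "shift Pos_Inf t = Pos_Inf"

text \<open>The interval with endpoints \<open>b\<close> and \<open>d\<close> consists of the \<open>t\<close> with $b \leq t^- < t^+ \leq d$;
  the lemma below spells out which endpoints are closed and which are open.\<close>

definition interval :: "decorated \<Rightarrow> decorated \<Rightarrow> real set" where
  "interval b d = {t. b \<le> Minus t \<and> Plus t \<le> d}"

lemma interval_simps:
  "interval (Minus s) (Plus t) = {s..t}"
  "interval (Minus s) (Minus t) = {s..<t}"
  "interval (Plus s) (Plus t) = {s<..t}"
  "interval (Plus s) (Minus t) = {s<..<t}"
  "interval Neg_Inf (Plus t) = {..t}"
  "interval Neg_Inf (Minus t) = {..<t}"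
  "interval (Minus s) Pos_Inf = {s..}"
  "interval (Plus s) Pos_Inf = {s<..}"
  "interval Neg_Inf Pos_Inf = UNIV"
  by (auto simp: interval_def less_eq_decorated_def)

lemma interval_nonempty_iff: "interval b d \<noteq> {} \<longleftrightarrow> b < d"
proof
  assume "interval b d \<noteq> {}"
  then obtain t where t: "b \<le> Minus t" "Plus t \<le> d"
    by (auto simp: interval_def)
  moreover have "Minus t < Plus t"
    by (simp add: less_decorated_def)
  ultimately show "b < d"
    by (meson le_less_trans less_le_trans)
next
  assume "b < d"
  define t where "t = (case b of
      Neg_Inf \<Rightarrow> (case d of Minus u \<Rightarrow> u - 1 | Plus u \<Rightarrow> u | _ \<Rightarrow> 0)
    | Minus s \<Rightarrow> s
    | Plus s \<Rightarrow> (case d of Minus u \<Rightarrow> (s + u) / 2 | Plus u \<Rightarrow> u | _ \<Rightarrow> s + 1)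
    | Pos_Inf \<Rightarrow> 0)"
  have "t \<in> interval b d"
    using \<open>b < d\<close>
    by (cases b; cases d)
      (simp_all add: t_def interval_def less_decorated_def less_eq_decorated_def)
  then show "interval b d \<noteq> {}"
    by blast
qed

section \<open>Persistence modules indexed by the reals\<close>

text \<open>The field is the type \<open>'f\<close>. All spaces \<open>space_at V t\<close> of a module are subspaces of one ambient
  vector space, the type \<open>'v\<close> with scalar multiplication \<open>scl V\<close>. This is no restriction, since
  every family of vector spaces embeds into its direct sum. The maps \<open>map_at V s t\<close> (the structure
  map for \<open>s \<le> t\<close>) and the components of morphisms are only relevant on the respective spaces.\<close>

record ('f, 'v) pmodule =
  scl :: "'f \<Rightarrow> 'v \<Rightarrow> 'v"
  space_at :: "real \<Rightarrow> 'v set"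
  map_at :: "real \<Rightarrow> real \<Rightarrow> 'v \<Rightarrow> 'v"

definition linear_between ::
    "('f \<Rightarrow> 'u::ab_group_add \<Rightarrow> 'u) \<Rightarrow> 'u set \<Rightarrow> ('f \<Rightarrow> 'v::ab_group_add \<Rightarrow> 'v) \<Rightarrow> 'v set
      \<Rightarrow> ('u \<Rightarrow> 'v) \<Rightarrow> bool" where
  "linear_between scale1 S scale2 T f \<longleftrightarrow>
     (\<forall>x\<in>S. f x \<in> T) \<and>
     (\<forall>x\<in>S. \<forall>y\<in>S. f (x + y) = f x + f y) \<and>
     (\<forall>c. \<forall>x\<in>S. f (scale1 c x) = scale2 c (f x))"

definition persistence_module :: "('f::field, 'v::ab_group_add) pmodule \<Rightarrow> bool" where
  "persistence_module V \<longleftrightarrow>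
     vector_space (scl V) \<and>
     (\<forall>t. module.subspace (scl V) (space_at V t)) \<and>
     (\<forall>s t. s \<le> t \<longrightarrow>
        linear_between (scl V) (space_at V s) (scl V) (space_at V t) (map_at V s t)) \<and>
     (\<forall>t. \<forall>x\<in>space_at V t. map_at V t t x = x) \<and>
     (\<forall>r s t. r \<le> s \<longrightarrow> s \<le> t \<longrightarrow>
        (\<forall>x\<in>space_at V r. map_at V s t (map_at V r s x) = map_at V r t x))"

definition morphism :: "('f, 'u::ab_group_add) pmodule \<Rightarrow> ('f, 'v::ab_group_add) pmodule
    \<Rightarrow> (real \<Rightarrow> 'u \<Rightarrow> 'v) \<Rightarrow> bool" where
  "morphism U V \<phi> \<longleftrightarrow>
     (\<forall>t. linear_between (scl U) (space_at U t) (scl V) (space_at V t) (\<phi> t)) \<and>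
     (\<forall>s t. s \<le> t \<longrightarrow>
        (\<forall>x\<in>space_at U s. \<phi> t (map_at U s t x) = map_at V s t (\<phi> s x)))"

definition isomorphic :: "('f, 'u::ab_group_add) pmodule \<Rightarrow> ('f, 'v::ab_group_add) pmodule \<Rightarrow> bool"
  where
  "isomorphic U V \<longleftrightarrow>
     (\<exists>\<phi> \<psi>. morphism U V \<phi> \<and> morphism V U \<psi> \<and>
        (\<forall>t. \<forall>x\<in>space_at U t. \<psi> t (\<phi> t x) = x) \<and>
        (\<forall>t. \<forall>y\<in>space_at V t. \<phi> t (\<psi> t y) = y))"

definition direct_sum :: "'i set \<Rightarrow> ('i \<Rightarrow> ('f, 'v::zero) pmodule) \<Rightarrow> ('f, 'i \<Rightarrow> 'v) pmodule" where
  "direct_sum I V =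
     \<lparr> scl = (\<lambda>c x i. scl (V i) c (x i)),
       space_at = (\<lambda>t. {x. finite {i. x i \<noteq> 0} \<and> (\<forall>i\<in>I. x i \<in> space_at (V i) t) \<and>
                           (\<forall>i. i \<notin> I \<longrightarrow> x i = 0)}),
       map_at = (\<lambda>s t x i. if i \<in> I then map_at (V i) s t (x i) else 0) \<rparr>"

definition interval_module :: "real set \<Rightarrow> ('f::field, 'f) pmodule" where
  "interval_module L =
     \<lparr> scl = (*),
       space_at = (\<lambda>t. if t \<in> L then UNIV else {0}),
       map_at = (\<lambda>s t x. if s \<in> L \<and> t \<in> L then x else 0) \<rparr>"

lemma persistence_module_interval_module:
  assumes "L = interval b d"
  shows "persistence_module (interval_module L :: ('f::field, 'f) pmodule)"
proof -
  interpret vector_space "(*) :: 'f \<Rightarrow> 'f \<Rightarrow> 'f"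
    by unfold_locales (simp_all add: algebra_simps)
  have conv: "s \<in> L" if "r \<in> L" "t \<in> L" "r \<le> s" "s \<le> t" for r s t
    using that unfolding assms interval_def less_eq_decorated_def
    by (cases b; cases d) auto
  have sub: "subspace (if t \<in> L then UNIV else {0})" for t
    by (simp add: subspace_def)
  show ?thesis
    unfolding persistence_module_def interval_module_def linear_between_def pmodule.simps
  proof (intro conjI allI impI ballI)
    fix r s t :: real and x :: 'f
    assume "r \<le> s" "s \<le> t" "x \<in> (if r \<in> L then UNIV else {0})"
    then show "(if s \<in> L \<and> t \<in> L then if r \<in> L \<and> s \<in> L then x else 0 else 0) =
        (if r \<in> L \<and> t \<in> L then x else 0)"
      using conv[of r t s] by (cases "s \<in> L") (auto split: if_splits)
  qed (fact vector_space_axioms sub | simp split: if_splits)+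
qed

lemma persistence_module_direct_sum:
  fixes V :: "'i \<Rightarrow> ('f::field, 'v::ab_group_add) pmodule"
  assumes "\<And>i. persistence_module (V i)"
  shows "persistence_module (direct_sum I V)"
proof -
  have vs: "vector_space (scl (V i))" for i
    using assms[of i] by (simp add: persistence_module_def)
  then have md: "module (scl (V i))" for i
    by (simp add: module_iff_vector_space)
  let ?scl = "\<lambda>c x i. scl (V i) c (x i)"
  have VS: "vector_space ?scl"
    unfolding vector_space_def plus_fun_def fun_eq_iff
    using vs unfolding vector_space_def by blast
  then have MD: "module ?scl"
    by (simp add: module_iff_vector_space)
  have sub: "module.subspace (scl (V i)) (space_at (V i) t)" for i t
    using assms[of i] by (simp add: persistence_module_def)
  have [simp]: "scl (V i) c 0 = 0" for i c
    using module.scale_zero_right[OF md] by blast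
  have lin: "linear_between (scl (V i)) (space_at (V i) s) (scl (V i)) (space_at (V i) t)
      (map_at (V i) s t)" if "s \<le> t" for i s t
    using assms[of i] that by (simp add: persistence_module_def)
  have zero: "0 \<in> space_at (V i) t" for i t
    using sub[of i t] by (simp add: module.subspace_def[OF md])
  have linD: "map_at (V i) s t x \<in> space_at (V i) t"
      "y \<in> space_at (V i) s \<Longrightarrow> map_at (V i) s t (x + y) = map_at (V i) s t x + map_at (V i) s t y"
      "map_at (V i) s t (scl (V i) c x) = scl (V i) c (map_at (V i) s t x)"
    if "s \<le> t" "x \<in> space_at (V i) s" for i s t x y c
    using lin[OF that(1), of i] that(2) unfolding linear_between_def by blast+
  have map0: "map_at (V i) s t 0 = 0" if "s \<le> t" for i s t
    using linD(2)[OF that zero zero, of i] by simp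
  have id: "map_at (V i) t t x = x" if "x \<in> space_at (V i) t" for i t x
    using assms[of i] that unfolding persistence_module_def by blast
  have comp: "map_at (V i) s t (map_at (V i) r s x) = map_at (V i) r t x"
    if "x \<in> space_at (V i) r" "r \<le> s" "s \<le> t" for i r s t x
    using assms[of i] that unfolding persistence_module_def by blast
  have subD: "x + y \<in> space_at (V i) t" "scl (V i) c x \<in> space_at (V i) t"
    if "x \<in> space_at (V i) t" "y \<in> space_at (V i) t" for i t x y c
    using sub[of i t] that unfolding module.subspace_def[OF md] by blast+
  let ?S = "\<lambda>t. {x. finite {i. x i \<noteq> 0} \<and> (\<forall>i\<in>I. x i \<in> space_at (V i) t) \<and>
      (\<forall>i. i \<notin> I \<longrightarrow> x i = 0)}"
  let ?m = "\<lambda>s t x i. if i \<in> I then map_at (V i) s t (x i) else 0"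
  have S_sub: "module.subspace ?scl (?S t)" for t
    unfolding module.subspace_def[OF MD]
  proof (intro conjI ballI allI)
    show "0 \<in> ?S t"
      using zero by simp
  next
    fix x y assume xy: "x \<in> ?S t" "y \<in> ?S t"
    have "finite {i. (x + y) i \<noteq> 0}"
      by (rule finite_subset[of _ "{i. x i \<noteq> 0} \<union> {i. y i \<noteq> 0}"]) (use xy in auto)
    then show "x + y \<in> ?S t"
      using xy subD(1) by simp
  next
    fix c x assume x: "x \<in> ?S t"
    have "finite {i. scl (V i) c (x i) \<noteq> 0}"
      by (rule finite_subset[of _ "{i. x i \<noteq> 0}"]) (use x in auto)
    then show "(\<lambda>i. scl (V i) c (x i)) \<in> ?S t"
      using x subD(2)[OF _ zero] by simp
  qed
  have S_lin: "linear_between ?scl (?S s) ?scl (?S t) (?m s t)" if st: "s \<le> t" for s t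
    unfolding linear_between_def
  proof (intro conjI ballI allI)
    fix x assume x: "x \<in> ?S s"
    have "finite {i. ?m s t x i \<noteq> 0}"
      by (rule finite_subset[of _ "{i. x i \<noteq> 0}"]) (use x map0[OF st] in auto)
    then show "?m s t x \<in> ?S t"
      using x linD(1)[OF st] by simp
  next
    fix x y assume "x \<in> ?S s" "y \<in> ?S s"
    then show "?m s t (x + y) = ?m s t x + ?m s t y"
      using linD(2)[OF st] by (simp add: fun_eq_iff)
  next
    fix c x assume "x \<in> ?S s"
    then show "?m s t (?scl c x) = ?scl c (?m s t x)"
      using linD(3)[OF st] by (simp add: fun_eq_iff)
  qed
  have S_id: "?m t t x = x" if "x \<in> ?S t" for t x
    using that id by (simp add: fun_eq_iff)
  have S_comp: "?m s t (?m r s x) = ?m r t x" if "r \<le> s" "s \<le> t" "x \<in> ?S r" for r s t x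
    using that(3) comp[OF _ that(1,2)] by (simp add: fun_eq_iff)
  show ?thesis
    unfolding persistence_module_def direct_sum_def pmodule.simps
    by (intro conjI allI impI ballI VS S_sub S_lin S_id S_comp)
qed

section \<open>Barcodes\<close>

text \<open>A barcode is a family \<open>B\<close> of pairs of endpoints indexed by a set \<open>I\<close>; a bar is identified with
  its pair of endpoints, which a nonempty interval determines uniquely. Since the
  multiset of bars of a module is unique, \<open>is_barcode I B V\<close> says that this family represents
  the barcode of \<open>V\<close>.\<close>

definition is_barcode :: "'i set \<Rightarrow> ('i \<Rightarrow> decorated \<times> decorated)
    \<Rightarrow> ('f::field, 'v::ab_group_add) pmodule \<Rightarrow> bool" where
  "is_barcode I B V \<longleftrightarrow>
     (\<forall>i\<in>I. interval (fst (B i)) (snd (B i)) \<noteq> {}) \<and>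
     isomorphic V (direct_sum I (\<lambda>i. interval_module (interval (fst (B i)) (snd (B i)))))"

definition locally_finite :: "'i set \<Rightarrow> ('i \<Rightarrow> decorated \<times> decorated) \<Rightarrow> bool" where
  "locally_finite I B \<longleftrightarrow>
     (\<forall>t. \<exists>N. open N \<and> t \<in> N \<and> finite {i\<in>I. interval (fst (B i)) (snd (B i)) \<inter> N \<noteq> {}})"

section \<open>Interleavings and matchings\<close>

definition shift_module :: "('f, 'v) pmodule \<Rightarrow> real \<Rightarrow> ('f, 'v) pmodule" where
  "shift_module V \<epsilon> =
     \<lparr> scl = scl V,
       space_at = (\<lambda>t. space_at V (t + \<epsilon>)),
       map_at = (\<lambda>s t. map_at V (s + \<epsilon>) (t + \<epsilon>)) \<rparr>"

definition interleaving :: "real \<Rightarrow> ('f, 'u::ab_group_add) pmodule \<Rightarrow> ('f, 'v::ab_group_add) pmodule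
    \<Rightarrow> (real \<Rightarrow> 'u \<Rightarrow> 'v) \<Rightarrow> (real \<Rightarrow> 'v \<Rightarrow> 'u) \<Rightarrow> bool" where
  "interleaving \<epsilon> U V \<phi> \<psi> \<longleftrightarrow>
     morphism U (shift_module V \<epsilon>) \<phi> \<and> morphism V (shift_module U \<epsilon>) \<psi> \<and>
     (\<forall>t. \<forall>x\<in>space_at U t. \<psi> (t + \<epsilon>) (\<phi> t x) = map_at U t (t + 2 * \<epsilon>) x) \<and>
     (\<forall>t. \<forall>y\<in>space_at V t. \<phi> (t + \<epsilon>) (\<psi> t y) = map_at V t (t + 2 * \<epsilon>) y)"

definition interleaving_distance ::
    "('f, 'u::ab_group_add) pmodule \<Rightarrow> ('f, 'v::ab_group_add) pmodule \<Rightarrow> ereal" where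
  "interleaving_distance U V = Inf {ereal \<epsilon> |\<epsilon>. 0 < \<epsilon> \<and> (\<exists>\<phi> \<psi>. interleaving \<epsilon> U V \<phi> \<psi>)}"

definition matching :: "'i set \<Rightarrow> 'j set \<Rightarrow> ('i \<times> 'j) set \<Rightarrow> bool" where
  "matching I J M \<longleftrightarrow> M \<subseteq> I \<times> J \<and>
     (\<forall>i j j'. (i, j) \<in> M \<longrightarrow> (i, j') \<in> M \<longrightarrow> j = j') \<and>
     (\<forall>i i' j. (i, j) \<in> M \<longrightarrow> (i', j) \<in> M \<longrightarrow> i = i')"

definition eps_matching :: "real \<Rightarrow> 'i set \<Rightarrow> ('i \<Rightarrow> decorated \<times> decorated)
    \<Rightarrow> 'j set \<Rightarrow> ('j \<Rightarrow> decorated \<times> decorated) \<Rightarrow> ('i \<times> 'j) set \<Rightarrow> bool" where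
  "eps_matching \<epsilon> I B J C M \<longleftrightarrow>
     matching I J M \<and>
     (\<forall>i\<in>I. (\<exists>a. {a..a + 2 * \<epsilon>} \<subseteq> interval (fst (B i)) (snd (B i))) \<longrightarrow> (\<exists>j. (i, j) \<in> M)) \<and>
     (\<forall>j\<in>J. (\<exists>a. {a..a + 2 * \<epsilon>} \<subseteq> interval (fst (C j)) (snd (C j))) \<longrightarrow> (\<exists>i. (i, j) \<in> M)) \<and>
     (\<forall>(i, j)\<in>M.
        interval (fst (B i)) (snd (B i)) \<subseteq> interval (shift (fst (C j)) (- \<epsilon>)) (shift (snd (C j)) \<epsilon>) \<and>
        interval (fst (C j)) (snd (C j)) \<subseteq> interval (shift (fst (B i)) (- \<epsilon>)) (shift (snd (B i)) \<epsilon>))"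

definition bottleneck_distance :: "'i set \<Rightarrow> ('i \<Rightarrow> decorated \<times> decorated)
    \<Rightarrow> 'j set \<Rightarrow> ('j \<Rightarrow> decorated \<times> decorated) \<Rightarrow> ereal" where
  "bottleneck_distance I B J C = Inf {ereal \<epsilon> |\<epsilon>. 0 < \<epsilon> \<and> (\<exists>M. eps_matching \<epsilon> I B J C M)}"

end

theory Submission
  imports Defs "HOL-Computational_Algebra.Polynomial"
begin

text \<open>
  In bases adapted to the bars, an interleaving is a pair of matrices whose product has an entry 1
  on the diagonal for each bar containing a closed interval of length \<open>2 * \<epsilon>\<close>. If bars \<open>b\<close>, \<open>b'\<close> satisfy
  \<open>midpoint b \<le> midpoint b'\<close> and nonzero coefficients lead from \<open>b\<close> through \<open>c\<close> to \<open>b'\<close>, then \<open>c\<close> is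
  \<open>\<epsilon>\<close>-close to \<open>b\<close> or to \<open>b'\<close> (an observation of Bjerkevik). Hence for a finite set \<open>A\<close> of long bars,
  already the bars close to some member of \<open>A\<close> produce a unitriangular product, so there are at
  least \<open>card A\<close> of them, which is Hall's condition. Local finiteness makes each set of close bars
  finite, and Hall's theorem for infinite families gives injections of the long bars of either
  barcode into the other; these combine to one matching as in the Schroeder--Bernstein theorem.
\<close>

subsection \<open>Systems of distinct representatives\<close>

text \<open>Finiteness of the sets keeps \<open>card\<close> meaningful and is what makes infinite
  \<open>A\<close> harmless: for the singletons {n} with n natural and one further set of all
  naturals, every finite subfamily has distinct representatives but the whole family has
  none.\<close>

definition hall_family :: "'i set \<Rightarrow> ('i \<Rightarrow> 'j set) \<Rightarrow> bool" where
  "hall_family A N \<longleftrightarrow> (\<forall>i\<in>A. finite (N i)) \<and>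
     (\<forall>X. finite X \<longrightarrow> X \<subseteq> A \<longrightarrow> card X \<le> card (\<Union>i\<in>X. N i))"

lemma hall_familyD:
  assumes "hall_family A N"
  shows "i \<in> A \<Longrightarrow> finite (N i)"
    and "finite X \<Longrightarrow> X \<subseteq> A \<Longrightarrow> card X \<le> card (\<Union>i\<in>X. N i)"
  using assms by (simp_all add: hall_family_def)

text \<open>At a single index a member of the chain with the fewest elements already attains the
  intersection; for finitely many indices the smaller of two comparable members serves both. Hall's
  condition tests finitely many indices at a time, so it passes to the intersection of a
  chain.\<close>

lemma chain_stabilises:
  fixes F :: "('i \<Rightarrow> 'j set) set"
  assumes chain: "\<And>M N. M \<in> F \<Longrightarrow> N \<in> F \<Longrightarrow> M \<le> N \<or> N \<le> M"
    and "F \<noteq> {}" and fin: "\<And>N i. N \<in> F \<Longrightarrow> i \<in> A \<Longrightarrow> finite (N i)"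
    and X: "finite X" "X \<subseteq> A"
  shows "\<exists>N\<in>F. \<forall>i\<in>X. N i = (\<Inter>M\<in>F. M i)"
  using X
proof (induction X rule: finite_induct)
  case empty
  then show ?case using \<open>F \<noteq> {}\<close> by blast
next
  case (insert k X)
  have "X \<subseteq> A" using insert.prems by simp
  from insert.IH[OF this]
  obtain N where N: "N \<in> F" "\<forall>i\<in>X. N i = (\<Inter>M\<in>F. M i)" ..
  obtain M where M: "M \<in> F" "\<And>L. L \<in> F \<Longrightarrow> card (M k) \<le> card (L k)"
    using ex_has_least_nat[of "\<lambda>L. L \<in> F" N "\<lambda>L. card (L k)"] N(1) by blast
  have "M k \<subseteq> L k" if L: "L \<in> F" for L
  proof (cases "M \<le> L")
    case False
    then have "L k \<subseteq> M k"
      using chain[OF L M(1)] by (auto simp: le_fun_def)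
    then have "L k = M k"
      using card_seteq[OF _ _ M(2)[OF L]] fin[OF M(1), of k] insert.prems by blast
    then show ?thesis by simp
  qed (simp add: le_fun_def)
  then have Mk: "L k = (\<Inter>M\<in>F. M k)" if "L \<in> F" "L \<le> M" for L
    using that le_funD[OF that(2), of k] by blast
  show ?case
  proof (cases "N \<le> M")
    case True
    then have "\<forall>i\<in>insert k X. N i = (\<Inter>M\<in>F. M i)"
      using N(2) Mk[OF N(1) True] by simp
    then show ?thesis using N(1) by (rule bexI)
  next
    case False
    then have "M \<le> N"
      using False chain[OF N(1) M(1)] by simp
    have "M i = (\<Inter>M\<in>F. M i)" if "i \<in> X" for i
    proof
      show "M i \<subseteq> (\<Inter>M\<in>F. M i)"
        using le_funD[OF \<open>M \<le> N\<close>, of i] bspec[OF N(2) that] by simp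
    qed (use M(1) in blast)
    then have "\<forall>i\<in>insert k X. M i = (\<Inter>M\<in>F. M i)"
      using Mk[OF M(1) order_refl] by simp
    then show ?thesis using M(1) by (rule bexI)
  qed
qed

text \<open>Rado's argument: in an inclusion-minimal family satisfying Hall's condition all sets are
  singletons. Minimal families exist because the sets are finite, so no finiteness of the
  index set is needed.\<close>

lemma hall_family_remove:
  assumes H: "hall_family A N" and i: "i \<in> A" and xy: "x \<in> N i" "y \<in> N i" "x \<noteq> y"
  shows "hall_family A (N(i := N i - {x})) \<or> hall_family A (N(i := N i - {y}))"
proof (rule ccontr)
  assume contra: "\<not> ?thesis"
  \<comment> \<open>A set violating the condition after the removal of \<open>z\<close> must contain
    \<open>i\<close>, since the sets at other indices are unchanged. Taking \<open>i\<close> out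
    lowers its cardinality by one, which turns the strict inequality into
    \<open>\<le>\<close>.\<close>
  have tight: "\<exists>X. finite X \<and> X \<subseteq> A \<and> i \<notin> X \<and>
      card ((\<Union>k\<in>X. N k) \<union> (N i - {z})) \<le> card X"
    if z: "\<not> hall_family A (N(i := N i - {z}))" for z
  proof -
    let ?N = "N(i := N i - {z})"
    have "\<forall>k\<in>A. finite (?N k)"
      using hall_familyD(1)[OF H] by auto
    then obtain X where X: "finite X" "X \<subseteq> A" "card (\<Union>k\<in>X. ?N k) < card X"
      using z unfolding hall_family_def by (auto simp: not_le)
    have "i \<in> X"
    proof (rule ccontr)
      assume "i \<notin> X"
      then have "(\<Union>k\<in>X. ?N k) = (\<Union>k\<in>X. N k)" by (auto split: if_splits)
      then show False using X hall_familyD(2)[OF H X(1,2)] by simp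
    qed
    then have "(\<Union>k\<in>X. ?N k) = (\<Union>k\<in>X - {i}. N k) \<union> (N i - {z})"
      by (auto split: if_splits)
    with X \<open>i \<in> X\<close> show ?thesis
      by (intro exI[of _ "X - {i}"]) auto
  qed
  obtain X where X: "finite X" "X \<subseteq> A" "i \<notin> X"
      "card ((\<Union>k\<in>X. N k) \<union> (N i - {x})) \<le> card X"
    using tight[of x] contra by auto
  obtain Y where Y: "finite Y" "Y \<subseteq> A" "i \<notin> Y"
      "card ((\<Union>k\<in>Y. N k) \<union> (N i - {y})) \<le> card Y"
    using tight[of y] contra by auto
  \<comment> \<open>Submodularity: the union of \<open>P\<close> and \<open>Q\<close> regains all of
    \<open>N i\<close> because \<open>x \<noteq> y\<close>, so it has at least
    \<open>card (X \<union> Y) + 1\<close> elements, and the intersection has at least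
    \<open>card (X \<inter> Y)\<close>. Together this exceeds \<open>card X + card Y\<close>, which
    bounds \<open>card P + card Q\<close>.\<close>
  define P where "P = (\<Union>k\<in>X. N k) \<union> (N i - {x})"
  define Q where "Q = (\<Union>k\<in>Y. N k) \<union> (N i - {y})"
  have fin: "finite P" "finite Q"
    using X Y i hall_familyD(1)[OF H] by (auto simp: P_def Q_def)
  have "P \<union> Q = (\<Union>k\<in>insert i (X \<union> Y). N k)"
    using xy by (auto simp: P_def Q_def)
  then have "card (insert i (X \<union> Y)) \<le> card (P \<union> Q)"
    using hall_familyD(2)[OF H, of "insert i (X \<union> Y)"] X Y i by simp
  then have 1: "card (X \<union> Y) + 1 \<le> card (P \<union> Q)"
    using X Y by simp
  have "card (X \<inter> Y) \<le> card (\<Union>k\<in>X \<inter> Y. N k)"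
    using hall_familyD(2)[OF H, of "X \<inter> Y"] X by auto
  also have "\<dots> \<le> card (P \<inter> Q)"
    by (rule card_mono) (use fin in \<open>auto simp: P_def Q_def\<close>)
  finally have 2: "card (X \<inter> Y) \<le> card (P \<inter> Q)" .
  have "card P + card Q = card (P \<union> Q) + card (P \<inter> Q)"
    using fin by (rule card_Un_Int)
  moreover have "card X + card Y = card (X \<union> Y) + card (X \<inter> Y)"
    using X Y by (intro card_Un_Int) auto
  ultimately show False
    using 1 2 X(4) Y(4) by (simp add: P_def Q_def)
qed

theorem hall_infinite:
  fixes N :: "'i \<Rightarrow> 'j set"
  assumes H: "hall_family A N"
  shows "\<exists>f. inj_on f A \<and> (\<forall>i\<in>A. f i \<in> N i)"
proof -
  let ?S = "{M. hall_family A M \<and> M \<le> N}"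
  \<comment> \<open>Zorn's lemma for the reversed pointwise order; a nonempty chain is bounded by
    its pointwise intersection \<open>L\<close>, which agrees on each finite \<open>X\<close> with
    some member.\<close>
  have "\<exists>M\<in>?S. \<forall>L\<in>?S. L \<le> M \<longrightarrow> L = M"
  proof (rule predicate_Zorn)
    show "partial_order_on ?S (relation_of (\<lambda>M L. L \<le> M) ?S)"
      by (rule partial_order_on_relation_ofI) simp_all
    show "\<exists>L\<in>?S. \<forall>M\<in>F. L \<le> M" if F: "F \<in> Chains (relation_of (\<lambda>M L. L \<le> M) ?S)" for F
    proof (cases "F = {}")
      case True
      with H show ?thesis by (intro bexI[of _ N]) simp_all
    next
      case False
      have FS: "hall_family A M" "M \<le> N" and chain: "M \<le> L \<or> L \<le> M"
        if "M \<in> F" "L \<in> F" for M L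
        using F that by (auto simp: Chains_def relation_of_def)
      obtain M\<^sub>0 where M\<^sub>0: "M\<^sub>0 \<in> F" using False by auto
      define L where "L = (\<lambda>i. \<Inter>M\<in>F. M i)"
      have fin: "finite (M i)" if "M \<in> F" "i \<in> A" for M i
        using hall_familyD(1)[OF FS(1)] that by simp
      have "hall_family A L"
        unfolding hall_family_def
      proof (intro conjI ballI allI impI)
        fix i assume "i \<in> A"
        then show "finite (L i)"
          using finite_subset[of "L i" "M\<^sub>0 i"] fin[OF M\<^sub>0] M\<^sub>0 by (auto simp: L_def)
      next
        fix X assume X: "finite X" "X \<subseteq> A"
        obtain M where M: "M \<in> F" "\<forall>i\<in>X. M i = L i"
        proof -
          have "\<exists>M\<in>F. \<forall>i\<in>X. M i = (\<Inter>M\<in>F. M i)"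
          proof (rule chain_stabilises[where A = A])
            show "M \<le> L \<or> L \<le> M" if "M \<in> F" "L \<in> F" for M L
              using that by (rule chain[of M L])
            show "finite (M i)" if "M \<in> F" "i \<in> A" for M i
              using that by (rule fin[of M i])
          qed (use False X in simp_all)
          then show ?thesis
            using that by (auto simp: L_def)
        qed
        then have "(\<Union>i\<in>X. M i) = (\<Union>i\<in>X. L i)" by simp
        then show "card X \<le> card (\<Union>i\<in>X. L i)"
          using hall_familyD(2)[OF FS(1)[OF M(1) M(1)] X] by simp
      qed
      moreover have LM: "L \<le> M" if "M \<in> F" for M
        using that by (auto simp: L_def le_fun_def)
      moreover have "L \<le> N"
        using LM[OF M\<^sub>0] FS(2)[OF M\<^sub>0 M\<^sub>0] by (rule order_trans)
      ultimately show ?thesis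
        by (intro bexI[of _ L]) simp_all
    qed
  qed
  then obtain M where M: "hall_family A M" "M \<le> N"
    and min: "\<forall>L\<in>?S. L \<le> M \<longrightarrow> L = M"
    by auto
  have sub: "x = y" if "i \<in> A" "x \<in> M i" "y \<in> M i" for i x y
  proof (rule ccontr)
    assume "x \<noteq> y"
    have "\<not> hall_family A (M(i := M i - {z}))" if "z \<in> M i" for z
    proof
      assume "hall_family A (M(i := M i - {z}))"
      moreover have le: "M(i := M i - {z}) \<le> M"
        by (simp add: le_fun_def)
      moreover have "M(i := M i - {z}) \<le> N"
        using le M(2) by (rule order_trans)
      ultimately have "M(i := M i - {z}) = M"
        using min by simp
      then have "(M(i := M i - {z})) i = M i"
        by (rule fun_cong)
      then show False
        using \<open>z \<in> M i\<close> by auto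
    qed
    then show False
      using hall_family_remove[OF M(1) that \<open>x \<noteq> y\<close>] that by simp
  qed
  have ne: "\<exists>x. x \<in> M i" if "i \<in> A" for i
    using hall_familyD(2)[OF M(1), of "{i}"] that by (cases "M i = {}") auto
  define f where "f = (\<lambda>i. SOME x. x \<in> M i)"
  have f: "f i \<in> M i" if "i \<in> A" for i
    using someI_ex[OF ne[OF that]] by (simp add: f_def)
  \<comment> \<open>Two equal singletons would violate Hall's condition at
    \<open>{i, k}\<close>.\<close>
  have "i = k" if "i \<in> A" "k \<in> A" "f i = f k" for i k
  proof (rule ccontr)
    assume "i \<noteq> k"
    have "M i = {f i}" "M k = {f i}"
      using f[OF that(1)] f[OF that(2)] sub[OF that(1)] sub[OF that(2)] that(3) by auto
    then have "(\<Union>l\<in>{i, k}. M l) = {f i}"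
      by simp
    then show False
      using hall_familyD(2)[OF M(1), of "{i, k}"] that \<open>i \<noteq> k\<close> by simp
  qed
  then have "inj_on f A"
    by (rule inj_onI)
  moreover have "\<forall>i\<in>A. f i \<in> N i"
    using f le_funD[OF M(2)] by blast
  ultimately show ?thesis by blast
qed

text \<open>The Schroeder--Bernstein argument: \<open>f\<close> is used on a fixed point \<open>X\<close> of
  \<open>X \<mapsto> A - g ` (A' - f ` X)\<close> and \<open>g\<close> on the rest.\<close>

lemma combine_matchings:
  assumes f: "inj_on f A" "A \<subseteq> I" "\<And>i. i \<in> A \<Longrightarrow> f i \<in> J \<and> R i (f i)"
    and g: "inj_on g A'" "A' \<subseteq> J" "\<And>j. j \<in> A' \<Longrightarrow> g j \<in> I \<and> R (g j) j"
  shows "\<exists>M. matching I J M \<and> (\<forall>i\<in>A. \<exists>j. (i, j) \<in> M) \<and> (\<forall>j\<in>A'. \<exists>i. (i, j) \<in> M) \<and>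
    (\<forall>(i, j)\<in>M. R i j)"
proof -
  define X where "X = lfp (\<lambda>X. A - g ` (A' - f ` X))"
  have "mono (\<lambda>X. A - g ` (A' - f ` X))"
    by (intro monoI Diff_mono image_mono order_refl)
  from lfp_unfold[OF this] have X: "X = A - g ` (A' - f ` X)"
    unfolding X_def .
  let ?M = "{(i, f i) |i. i \<in> X} \<union> {(g j, j) |j. j \<in> A' - f ` X}"
  have XA: "X \<subseteq> A" and Xg: "i \<in> X \<Longrightarrow> j \<in> A' \<Longrightarrow> j \<notin> f ` X \<Longrightarrow> i \<noteq> g j" for i j
    using X by blast+
  have "matching I J ?M"
    unfolding matching_def
    using f g XA Xg by (auto dest: inj_onD) (metis inj_onD subsetD)+
  moreover have "\<forall>i\<in>A. \<exists>j. (i, j) \<in> ?M" using X by blast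
  moreover have "\<forall>j\<in>A'. \<exists>i. (i, j) \<in> ?M" by blast
  moreover have "\<forall>(i, j)\<in>?M. R i j" using XA f(3) g(3) by auto
  ultimately show ?thesis by blast
qed

subsection \<open>A rank estimate\<close>

text \<open>Gaussian elimination: an equation \<open>k\<close> with a nonzero coefficient at
  \<open>l\<close> eliminates the unknown \<open>l\<close>, and the numbers of equations and
  unknowns both drop by one.\<close>

lemma homogeneous_system:
  fixes p :: "'i \<Rightarrow> 'j \<Rightarrow> 'f::field"
  assumes "finite K" and "finite A" and "card K < card A"
  shows "\<exists>c. (\<exists>i\<in>A. c i \<noteq> 0) \<and> (\<forall>j\<in>K. (\<Sum>i\<in>A. c i * p i j) = 0)"
  using assms
proof (induction K arbitrary: A p rule: finite_induct)
  case empty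
  then have "A \<noteq> {}" by auto
  then show ?case by (intro exI[of _ "\<lambda>_. 1"]) auto
next
  case (insert k K)
  show ?case
  proof (cases "\<forall>i\<in>A. p i k = 0")
    case True
    then show ?thesis
      using insert.IH[of A p] insert.prems insert.hyps by auto
  next
    case False
    then obtain l where l: "l \<in> A" "p l k \<noteq> 0" by blast
    define r where "r = (\<lambda>i. p i k / p l k)"
    obtain c where c: "\<exists>i\<in>A - {l}. c i \<noteq> 0"
        "\<And>j. j \<in> K \<Longrightarrow> (\<Sum>i\<in>A - {l}. c i * (p i j - r i * p l j)) = 0"
    proof -
      have "card K < card (A - {l})"
        using insert.prems insert.hyps l by simp
      then show ?thesis
        using insert.IH[of "A - {l}" "\<lambda>i j. p i j - r i * p l j"] insert.prems(1) that by blast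
    qed
    \<comment> \<open>The value at \<open>l\<close> solves equation \<open>k\<close>. Substituting
      it turns each sum over \<open>A\<close> into the reduced sum over \<open>A - {l}\<close>,
      which for \<open>j = k\<close> vanishes term by term since
      \<open>r i * p l k = p i k\<close>.\<close>
    define c' where "c' = c(l := - (\<Sum>i\<in>A - {l}. c i * r i))"
    have eq: "(\<Sum>i\<in>A. c' i * p i j) = (\<Sum>i\<in>A - {l}. c i * (p i j - r i * p l j))" for j
    proof -
      have "(\<Sum>i\<in>A. c' i * p i j) = c' l * p l j + (\<Sum>i\<in>A - {l}. c' i * p i j)"
        using insert.prems(1) l(1) by (rule sum.remove)
      also have "(\<Sum>i\<in>A - {l}. c' i * p i j) = (\<Sum>i\<in>A - {l}. c i * p i j)"
        by (rule sum.cong) (auto simp: c'_def)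
      finally show ?thesis
        by (simp add: c'_def algebra_simps sum_subtractf sum_distrib_left)
    qed
    have "(\<Sum>i\<in>A. c' i * p i j) = 0" if "j \<in> insert k K" for j
      using that c(2) l(2) unfolding eq by (auto simp: r_def)
    moreover have "\<exists>i\<in>A. c' i \<noteq> 0"
      using c(1) by (auto simp: c'_def)
    ultimately show ?thesis by blast
  qed
qed

text \<open>If \<open>K\<close> were smaller than \<open>A\<close>, the rows of \<open>p\<close>
  would satisfy a nontrivial relation \<open>c\<close>. Multiplying it by the column of
  \<open>q\<close> at an index \<open>m\<close> of largest \<open>key\<close> in the support of
  \<open>c\<close> involves only entries covered by \<open>tri\<close>, and leaves
  \<open>c m = 0\<close>.\<close>

lemma card_le_triangular:
  fixes p :: "'i \<Rightarrow> 'j \<Rightarrow> 'f::field" and key :: "'i \<Rightarrow> 'k::linorder"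
  assumes fin: "finite K" "finite A"
    and tri: "\<And>i i'. i \<in> A \<Longrightarrow> i' \<in> A \<Longrightarrow> key i \<le> key i' \<Longrightarrow>
      (\<Sum>j\<in>K. p i j * q j i') = (if i = i' then 1 else 0)"
  shows "card A \<le> card K"
proof (rule ccontr)
  assume "\<not> card A \<le> card K"
  then obtain c where c: "\<exists>i\<in>A. c i \<noteq> 0" "\<And>j. j \<in> K \<Longrightarrow> (\<Sum>i\<in>A. c i * p i j) = 0"
    using homogeneous_system[OF fin, of p] by auto
  let ?S = "{i\<in>A. c i \<noteq> 0}"
  have S: "finite ?S" "?S \<noteq> {}"
    using fin c(1) by auto
  have "Max (key ` ?S) \<in> key ` ?S"
    using S by (intro Max_in) auto
  then obtain m where m: "m \<in> ?S" "key m = Max (key ` ?S)"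
    by (rule imageE) (use that in auto)
  have max: "key i \<le> key m" if "i \<in> ?S" for i
    unfolding m(2) using that S(1) by (intro Max_ge) auto
  have "0 = (\<Sum>j\<in>K. (\<Sum>i\<in>A. c i * p i j) * q j m)"
    using c(2) by simp
  also have "\<dots> = (\<Sum>i\<in>A. \<Sum>j\<in>K. c i * p i j * q j m)"
    unfolding sum_distrib_right by (rule sum.swap)
  also have "\<dots> = (\<Sum>i\<in>A. c i * (\<Sum>j\<in>K. p i j * q j m))"
    by (simp add: sum_distrib_left mult.assoc)
  also have "\<dots> = (\<Sum>i\<in>A. if i = m then c m else 0)"
  proof (rule sum.cong)
    fix i assume "i \<in> A"
    then show "c i * (\<Sum>j\<in>K. p i j * q j m) = (if i = m then c m else 0)"
      using tri[of i m] m(1) max[of i] by (cases "c i = 0") auto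
  qed simp
  also have "\<dots> = c m"
    using m fin by simp
  finally show False
    using m by simp
qed

subsection \<open>Endpoints of bars\<close>

lemma mem_interval: "t \<in> interval b d \<longleftrightarrow> b \<le> Minus t \<and> Plus t \<le> d"
  by (simp add: interval_def)

lemma decorated_order_simps [simp]:
  "Minus s \<le> Minus t \<longleftrightarrow> s \<le> t" "Plus s \<le> Plus t \<longleftrightarrow> s \<le> t"
  "Minus s \<le> Plus t \<longleftrightarrow> s \<le> t" "Plus s \<le> Minus t \<longleftrightarrow> s < t"
  by (simp_all add: less_eq_decorated_def)

lemma shift_shift [simp]: "shift (shift x s) t = shift x (s + t)"
  by (cases x) auto

lemma shift_zero [simp]: "shift x 0 = x"
  by (cases x) auto

lemma shift_le_iff: "shift x s \<le> y \<longleftrightarrow> x \<le> shift y (- s)"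
  by (cases x; cases y) (auto simp: less_eq_decorated_def)

lemma shift_le_shift [simp]: "shift x e \<le> shift y e \<longleftrightarrow> x \<le> y"
  by (simp add: shift_le_iff)

lemma mem_interval_shift: "t \<in> interval (shift b s) (shift d u) \<longleftrightarrow> b \<le> Minus (t - s) \<and> Plus (t - u) \<le> d"
  using shift_le_iff[of b s "Minus t"] shift_le_iff[of "Plus t" "- u" d]
  by (simp add: mem_interval)

lemma mem_interval_mono:
  "r \<in> interval b d \<Longrightarrow> t \<in> interval b d \<Longrightarrow> r \<le> s \<Longrightarrow> s \<le> t \<Longrightarrow> s \<in> interval b d"
  using order_trans[of b "Minus r" "Minus s"] order_trans[of "Plus s" "Plus t" d]
  by (simp add: mem_interval)

text \<open>Endpoints are compared in the ordered ring of real polynomials, where the indeterminate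
  \<open>X\<close> is infinitely large: $t^\pm$ becomes $tX \pm 1$ and $\pm\infty$ becomes $\pm X^2$. There
  the midpoint order of bars makes sense for all types of endpoints at once.\<close>

fun emb :: "decorated \<Rightarrow> real poly" where
  "emb Neg_Inf = [:0, 0, -1:]"
| "emb (Minus t) = [:-1, t:]"
| "emb (Plus t) = [:1, t:]"
| "emb Pos_Inf = [:0, 0, 1:]"

text \<open>Only the comparison is preserved, since \<open>shift\<close> fixes an infinite endpoint
  while adding \<open>[:0, e:]\<close> moves its image. The quadratic term hides this unless both
  endpoints are infinite of the same sign, and there \<open>0 \<le> e\<close> decides.\<close>

lemma le_shift_iff_emb:
  assumes "0 \<le> e"
  shows "x \<le> shift y e \<longleftrightarrow> emb x \<le> emb y + [:0, e:]"
  using assms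
  by (cases x; cases y) (auto simp: less_eq_decorated_def less_eq_poly_def pos_poly_pCons)

subsection \<open>Morphisms and interleavings\<close>

lemma linear_between_comp:
  assumes "linear_between s\<^sub>1 S s\<^sub>2 T f" and "linear_between s\<^sub>2 T s\<^sub>3 R g"
  shows "linear_between s\<^sub>1 S s\<^sub>3 R (\<lambda>x. g (f x))"
  using assms by (simp add: linear_between_def)

lemma morphismD:
  assumes "morphism U V \<phi>"
  shows "linear_between (scl U) (space_at U t) (scl V) (space_at V t) (\<phi> t)"
    and "x \<in> space_at U s \<Longrightarrow> \<phi> s x \<in> space_at V s"
    and "s \<le> t \<Longrightarrow> x \<in> space_at U s \<Longrightarrow> \<phi> t (map_at U s t x) = map_at V s t (\<phi> s x)"
  using assms by (simp_all add: morphism_def linear_between_def)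

lemma morphism_comp:
  assumes "morphism U V \<phi>" and "morphism V W \<psi>"
  shows "morphism U W (\<lambda>t x. \<psi> t (\<phi> t x))"
  unfolding morphism_def
  using linear_between_comp[OF morphismD(1)[OF assms(1)] morphismD(1)[OF assms(2)]]
    morphismD(2,3)[OF assms(1)] morphismD(3)[OF assms(2)]
  by simp

lemma shift_module_simps [simp]:
  "scl (shift_module V e) = scl V"
  "space_at (shift_module V e) t = space_at V (t + e)"
  "map_at (shift_module V e) s t = map_at V (s + e) (t + e)"
  by (simp_all add: shift_module_def)

lemma morphism_shift_module:
  "morphism U V \<phi> \<Longrightarrow> morphism (shift_module U e) (shift_module V e) (\<lambda>t. \<phi> (t + e))"
  by (simp add: morphism_def)

lemma isomorphic_sym: "isomorphic U V \<Longrightarrow> isomorphic V U"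
  unfolding isomorphic_def by blast

lemma interleaving_sym: "interleaving e U V \<phi> \<psi> \<Longrightarrow> interleaving e V U \<psi> \<phi>"
  unfolding interleaving_def by blast

text \<open>Conjugation by the isomorphisms, used to pass between a module and its sum of interval
  modules. The persistence module axioms put the values of the structure maps into the spaces on
  which \<open>f\<close> inverts \<open>f'\<close> and \<open>g\<close> inverts
  \<open>g'\<close>.\<close>

lemma interleaving_transfer:
  assumes int: "interleaving e U V \<phi> \<psi>" and "0 \<le> e"
    and iso: "isomorphic U U'" "isomorphic V V'"
    and pm: "persistence_module U'" "persistence_module V'"
  shows "\<exists>\<phi>' \<psi>'. interleaving e U' V' \<phi>' \<psi>'"
proof -
  obtain f f' where f: "morphism U U' f" "morphism U' U f'"
      "\<And>t x. x \<in> space_at U t \<Longrightarrow> f' t (f t x) = x" "\<And>t x. x \<in> space_at U' t \<Longrightarrow> f t (f' t x) = x"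
    using iso(1) unfolding isomorphic_def by auto
  obtain g g' where g: "morphism V V' g" "morphism V' V g'"
      "\<And>t x. x \<in> space_at V t \<Longrightarrow> g' t (g t x) = x" "\<And>t x. x \<in> space_at V' t \<Longrightarrow> g t (g' t x) = x"
    using iso(2) unfolding isomorphic_def by auto
  have \<phi>: "morphism U (shift_module V e) \<phi>" and \<psi>: "morphism V (shift_module U e) \<psi>"
    and \<psi>\<phi>: "\<And>t x. x \<in> space_at U t \<Longrightarrow> \<psi> (t + e) (\<phi> t x) = map_at U t (t + 2 * e) x"
    and \<phi>\<psi>: "\<And>t x. x \<in> space_at V t \<Longrightarrow> \<phi> (t + e) (\<psi> t x) = map_at V t (t + 2 * e) x"
    using int by (auto simp: interleaving_def)
  have le: "t \<le> t + 2 * e" for t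
    using \<open>0 \<le> e\<close> by simp
  have map_mem: "map_at U' t (t + 2 * e) x \<in> space_at U' (t + 2 * e)" if "x \<in> space_at U' t" for t x
    using pm(1) le that by (simp add: persistence_module_def linear_between_def)
  have map_mem': "map_at V' t (t + 2 * e) x \<in> space_at V' (t + 2 * e)" if "x \<in> space_at V' t" for t x
    using pm(2) le that by (simp add: persistence_module_def linear_between_def)
  define \<phi>' where "\<phi>' = (\<lambda>t x. g (t + e) (\<phi> t (f' t x)))"
  define \<psi>' where "\<psi>' = (\<lambda>t x. f (t + e) (\<psi> t (g' t x)))"
  have "morphism U' (shift_module V' e) \<phi>'"
    unfolding \<phi>'_def by (rule morphism_comp[OF morphism_comp[OF f(2) \<phi>] morphism_shift_module[OF g(1)]])
  moreover have "morphism V' (shift_module U' e) \<psi>'"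
    unfolding \<psi>'_def by (rule morphism_comp[OF morphism_comp[OF g(2) \<psi>] morphism_shift_module[OF f(1)]])
  moreover have "\<psi>' (t + e) (\<phi>' t x) = map_at U' t (t + 2 * e) x" if "x \<in> space_at U' t" for t x
  proof -
    have x: "f' t x \<in> space_at U t"
      using morphismD(2)[OF f(2) that] .
    have "\<psi>' (t + e) (\<phi>' t x) = f (t + 2 * e) (\<psi> (t + e) (\<phi> t (f' t x)))"
      using morphismD(2)[OF \<phi> x] g(3) by (simp add: \<phi>'_def \<psi>'_def add.assoc)
    also have "\<dots> = f (t + 2 * e) (f' (t + 2 * e) (map_at U' t (t + 2 * e) x))"
      using \<psi>\<phi>[OF x] morphismD(3)[OF f(2) le that] by simp
    also have "\<dots> = map_at U' t (t + 2 * e) x"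
      using f(4) map_mem[OF that] .
    finally show ?thesis .
  qed
  moreover have "\<phi>' (t + e) (\<psi>' t x) = map_at V' t (t + 2 * e) x" if "x \<in> space_at V' t" for t x
  proof -
    have x: "g' t x \<in> space_at V t"
      using morphismD(2)[OF g(2) that] .
    have "\<phi>' (t + e) (\<psi>' t x) = g (t + 2 * e) (\<phi> (t + e) (\<psi> t (g' t x)))"
      using morphismD(2)[OF \<psi> x] f(3) by (simp add: \<phi>'_def \<psi>'_def add.assoc)
    also have "\<dots> = g (t + 2 * e) (g' (t + 2 * e) (map_at V' t (t + 2 * e) x))"
      using \<phi>\<psi>[OF x] morphismD(3)[OF g(2) le that] by simp
    also have "\<dots> = map_at V' t (t + 2 * e) x"
      using g(4) map_mem'[OF that] .
    finally show ?thesis .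
  qed
  ultimately have "interleaving e U' V' \<phi>' \<psi>'"
    by (simp add: interleaving_def)
  then show ?thesis by blast
qed

section \<open>Sums of interval modules in coordinates\<close>

abbreviation bar :: "('i \<Rightarrow> decorated \<times> decorated) \<Rightarrow> 'i \<Rightarrow> real set" where
  "bar B i \<equiv> interval (fst (B i)) (snd (B i))"

abbreviation barsum :: "'i set \<Rightarrow> ('i \<Rightarrow> decorated \<times> decorated) \<Rightarrow> ('f::field, 'i \<Rightarrow> 'f) pmodule" where
  "barsum I B \<equiv> direct_sum I (\<lambda>i. interval_module (bar B i))"

lemma scl_barsum: "scl (barsum I B) = (\<lambda>c x i. c * x i)"
  by (simp add: direct_sum_def interval_module_def)

lemma space_barsum:
  "x \<in> space_at (barsum I B) t \<longleftrightarrow>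
    finite {i. x i \<noteq> 0} \<and> (\<forall>i. x i \<noteq> 0 \<longrightarrow> i \<in> I \<and> t \<in> bar B i)"
  by (auto simp: direct_sum_def interval_module_def)

lemma map_barsum:
  "map_at (barsum I B) s t x = (\<lambda>i. if i \<in> I \<and> s \<in> bar B i \<and> t \<in> bar B i then x i else 0)"
  by (auto simp: direct_sum_def interval_module_def)

lemma persistence_module_barsum: "persistence_module (barsum I B)"
  by (rule persistence_module_direct_sum) (rule persistence_module_interval_module[OF refl])

subsection \<open>From matchings to interleavings\<close>

text \<open>The sum over the matched pairs of the canonical maps between interval modules; unmatched
  bars are sent to 0. Membership of \<open>t\<close> in the source bar is not tested, because
  coordinates of vectors at \<open>t\<close> vanish outside their bars.\<close>

definition transport :: "real \<Rightarrow> ('i \<times> 'j) set \<Rightarrow> ('j \<Rightarrow> decorated \<times> decorated) \<Rightarrow> real \<Rightarrow> ('i \<Rightarrow> 'f::field) \<Rightarrow> 'j \<Rightarrow> 'f"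
  where "transport e M C t x =
    (\<lambda>j. if t + e \<in> bar C j \<and> (\<exists>i. (i, j) \<in> M) then x (THE i. (i, j) \<in> M) else 0)"

lemma matching_converse: "matching I J M \<Longrightarrow> matching J I (M\<inverse>)"
  by (auto simp: matching_def)

lemma eps_matching_converse: "eps_matching e I B J C M \<Longrightarrow> eps_matching e J C I B (M\<inverse>)"
  unfolding eps_matching_def using matching_converse by auto

lemma eps_matching_sub:
  assumes "eps_matching e I B J C M" and "(i, j) \<in> M"
  shows "t \<in> bar B i \<Longrightarrow> fst (C j) \<le> Minus (t + e) \<and> Plus (t - e) \<le> snd (C j)"
  and "t \<in> bar C j \<Longrightarrow> fst (B i) \<le> Minus (t + e) \<and> Plus (t - e) \<le> snd (B i)"
proof -
  have "bar B i \<subseteq> interval (shift (fst (C j)) (- e)) (shift (snd (C j)) e)"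
    "bar C j \<subseteq> interval (shift (fst (B i)) (- e)) (shift (snd (B i)) e)"
    using assms unfolding eps_matching_def by blast+
  then show "t \<in> bar B i \<Longrightarrow> fst (C j) \<le> Minus (t + e) \<and> Plus (t - e) \<le> snd (C j)"
    and "t \<in> bar C j \<Longrightarrow> fst (B i) \<le> Minus (t + e) \<and> Plus (t - e) \<le> snd (B i)"
    using mem_interval_shift by fastforce+
qed

lemma transport_eq:
  assumes "matching I J M" and "(i, j) \<in> M"
  shows "transport e M C t x j = (if t + e \<in> bar C j then x i else 0)"
proof -
  have "(THE i. (i, j) \<in> M) = i"
    using assms by (intro the_equality) (auto simp: matching_def)
  then show ?thesis
    using assms(2) by (auto simp: transport_def)
qed

lemma transport_nonzeroE:
  assumes "transport e M C t x j \<noteq> 0" and "matching I J M"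
  obtains i where "(i, j) \<in> M" and "t + e \<in> bar C j" and "x i \<noteq> 0"
proof -
  obtain i where i: "(i, j) \<in> M"
    using assms(1) by (auto simp: transport_def split: if_splits)
  then show thesis
    using assms(1) that[OF i] by (simp add: transport_eq[OF assms(2) i] split: if_splits)
qed

lemma morphism_transport:
  fixes B :: "'i \<Rightarrow> decorated \<times> decorated" and C :: "'j \<Rightarrow> decorated \<times> decorated"
  assumes M: "eps_matching e I B J C M"
  shows "morphism (barsum I B :: ('f::field, 'i \<Rightarrow> 'f) pmodule) (shift_module (barsum J C) e) (transport e M C)"
proof -
  have mat: "matching I J M"
    using M by (simp add: eps_matching_def)
  have mem: "transport e M C t x \<in> space_at (barsum J C) (t + e)"
    if x: "x \<in> space_at (barsum I B) t" for t and x :: "'i \<Rightarrow> 'f"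
  proof -
    have "{j. transport e M C t x j \<noteq> 0} \<subseteq> (\<lambda>i. THE j. (i, j) \<in> M) ` {i. x i \<noteq> 0}"
    proof
      fix j assume "j \<in> {j. transport e M C t x j \<noteq> 0}"
      then obtain i where i: "(i, j) \<in> M" "x i \<noteq> 0"
        using mat by (auto elim: transport_nonzeroE)
      then have "(THE j. (i, j) \<in> M) = j"
        using mat by (intro the_equality) (auto simp: matching_def)
      then show "j \<in> (\<lambda>i. THE j. (i, j) \<in> M) ` {i. x i \<noteq> 0}"
        using i(2) by force
    qed
    moreover have "finite {i. x i \<noteq> 0}"
      using x by (simp add: space_barsum)
    ultimately have "finite {j. transport e M C t x j \<noteq> 0}"
      by (meson finite_imageI finite_subset)
    moreover have "j \<in> J \<and> t + e \<in> bar C j" if "transport e M C t x j \<noteq> 0" for j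
      using that mat by (rule transport_nonzeroE) (use mat in \<open>auto simp: matching_def\<close>)
    ultimately show ?thesis
      by (simp add: space_barsum)
  qed
  have nat: "transport e M C t (map_at (barsum I B) s t x) =
      map_at (barsum J C) (s + e) (t + e) (transport e M C s x)"
    if st: "s \<le> t" and x: "x \<in> space_at (barsum I B) s" for s t and x :: "'i \<Rightarrow> 'f"
  proof
    fix j
    show "transport e M C t (map_at (barsum I B) s t x) j =
      map_at (barsum J C) (s + e) (t + e) (transport e M C s x) j"
    proof (cases "\<exists>i. (i, j) \<in> M")
      case False
      then show ?thesis by (simp add: transport_def map_barsum)
    next
      case True
      then obtain i where ij: "(i, j) \<in> M" by blast
      have I: "i \<in> I" "j \<in> J"
        using ij mat by (auto simp: matching_def)
      \<comment> \<open>The two ways around the naturality square differ only in which of these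
        memberships they test. Both hold: each bar gets one endpoint inequality from its own point
        by monotonicity and the other from the point of its partner.\<close>
      have "t \<in> bar B i \<longleftrightarrow> s + e \<in> bar C j" if s: "s \<in> bar B i" and t: "t + e \<in> bar C j"
      proof
        assume "t \<in> bar B i"
        have "fst (C j) \<le> Minus (s + e)"
          using eps_matching_sub(1)[OF M ij s] by simp
        moreover have "Plus (s + e) \<le> snd (C j)"
          using t st order_trans[of "Plus (s + e)" "Plus (t + e)"] by (simp add: mem_interval)
        ultimately show "s + e \<in> bar C j"
          by (simp add: mem_interval)
      next
        have "Plus t \<le> snd (B i)"
          using eps_matching_sub(2)[OF M ij t] by simp
        moreover have "fst (B i) \<le> Minus t"
          using s st order_trans[of _ "Minus s" "Minus t"] by (simp add: mem_interval)
        ultimately show "t \<in> bar B i"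
          by (simp add: mem_interval)
      qed
      moreover have "s \<in> bar B i" if "x i \<noteq> 0"
        using x that by (simp add: space_barsum)
      ultimately show ?thesis
        using I by (auto simp: transport_eq[OF mat ij] map_barsum)
    qed
  qed
  show ?thesis
    unfolding morphism_def linear_between_def
    using mem nat by (auto simp: scl_barsum) (auto simp: transport_def fun_eq_iff)
qed

text \<open>A bar containing \<open>t\<close> and \<open>t + 2 * e\<close> contains the closed
  interval between them, so it is matched, and the inclusions at both ends put \<open>t + e\<close>
  into its partner; the coordinate survives the round trip. An unmatched bar cannot contain both
  points, so both sides vanish there.\<close>

lemma transport_transport:
  fixes B :: "'i \<Rightarrow> decorated \<times> decorated" and C :: "'j \<Rightarrow> decorated \<times> decorated"
  assumes M: "eps_matching e I B J C M" and "0 \<le> e"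
    and x: "(x :: 'i \<Rightarrow> 'f::field) \<in> space_at (barsum I B) t"
  shows "transport e (M\<inverse>) B (t + e) (transport e M C t x) = map_at (barsum I B) t (t + 2 * e) x"
proof
  fix i
  have mat: "matching I J M" "matching J I (M\<inverse>)"
    using M matching_converse by (auto simp: eps_matching_def)
  have long: "\<exists>j. (i, j) \<in> M \<and> t + e \<in> bar C j" if i: "i \<in> I" and t: "t \<in> bar B i" "t + 2 * e \<in> bar B i"
  proof -
    have "{t..t + 2 * e} \<subseteq> bar B i"
      using mem_interval_mono[OF t] by auto
    then obtain j where j: "(i, j) \<in> M"
      using M i unfolding eps_matching_def by blast
    then have "t + e \<in> bar C j"
      using eps_matching_sub(1)[OF M j t(1)] eps_matching_sub(1)[OF M j t(2)]
      by (simp add: mem_interval add.commute)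
    with j show ?thesis by blast
  qed
  show "transport e (M\<inverse>) B (t + e) (transport e M C t x) i = map_at (barsum I B) t (t + 2 * e) x i"
  proof (cases "\<exists>j. (i, j) \<in> M")
    case False
    then show ?thesis
      using long by (auto simp: transport_def map_barsum)
  next
    case True
    then obtain j where j: "(i, j) \<in> M" by blast
    have "i \<in> I"
      using j mat by (auto simp: matching_def)
    have eq: "transport e (M\<inverse>) B (t + e) (transport e M C t x) i =
        (if t + 2 * e \<in> bar B i \<and> t + e \<in> bar C j then x i else 0)"
      using j by (simp add: transport_eq[OF mat(2), of j i] transport_eq[OF mat(1) j] add.assoc)
    have "t \<in> bar B i" if "x i \<noteq> 0"
      using x that by (simp add: space_barsum)
    moreover have "t + e \<in> bar C j" if t: "t \<in> bar B i" "t + 2 * e \<in> bar B i"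
          proof -
      obtain j' where j': "(i, j') \<in> M" "t + e \<in> bar C j'"
        using long[OF \<open>i \<in> I\<close> t] by blast
      then have "j' = j"
        using mat(1) j unfolding matching_def by blast
      with j' show ?thesis by simp
    qed
    ultimately show ?thesis
      using \<open>i \<in> I\<close> unfolding eq by (auto simp: map_barsum)
  qed
qed

lemma interleaving_transport:
  fixes B :: "'i \<Rightarrow> decorated \<times> decorated" and C :: "'j \<Rightarrow> decorated \<times> decorated"
  assumes "eps_matching e I B J C M" and "0 \<le> e"
  shows "interleaving e (barsum I B) (barsum J C :: ('f::field, 'j \<Rightarrow> 'f) pmodule)
    (transport e M C) (transport e (M\<inverse>) B)"
  unfolding interleaving_def
  using morphism_transport[OF assms(1)] morphism_transport[OF eps_matching_converse[OF assms(1)]]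
    transport_transport[OF assms] transport_transport[OF eps_matching_converse[OF assms(1)] assms(2)]
  by (intro conjI allI ballI) simp_all

subsection \<open>Matrix coefficients of morphisms\<close>

definition unit_vec :: "'i \<Rightarrow> 'i \<Rightarrow> 'f::field" where
  "unit_vec i = (\<lambda>k. if k = i then 1 else 0)"

lemma unit_vec_mem: "i \<in> I \<Longrightarrow> t \<in> bar B i \<Longrightarrow> unit_vec i \<in> space_at (barsum I B) t"
  by (auto simp: unit_vec_def space_barsum)

lemma linear_between_0:
  assumes "linear_between s\<^sub>1 S s\<^sub>2 T f" and "0 \<in> S"
  shows "f 0 = 0"
proof -
  have "f (0 + 0) = f 0 + f 0"
    using assms unfolding linear_between_def by blast
  then show ?thesis by simp
qed

text \<open>Induction on the support: \<open>linear_between\<close> grants additivity only for two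
  members of the space, so one coordinate is split off at a time.\<close>

lemma linear_expansion:
  fixes B :: "'i \<Rightarrow> decorated \<times> decorated" and x :: "'i \<Rightarrow> 'f::field"
  assumes lin: "linear_between (scl (barsum I B)) (space_at (barsum I B) t) (scl (barsum J C)) T f"
    and x: "x \<in> space_at (barsum I B) t"
  shows "f x j = (\<Sum>i | x i \<noteq> 0. x i * f (unit_vec i) j)"
proof -
  have "f x j = (\<Sum>i\<in>S. x i * f (unit_vec i) j)"
    if "finite S" "{i. x i \<noteq> 0} = S" "x \<in> space_at (barsum I B) t" for S x
    using that
  proof (induction S arbitrary: x rule: finite_induct)
    case empty
    then have x: "x = 0"
      by (auto simp: fun_eq_iff)
    have "f 0 = 0"
      using empty.prems(2) unfolding x by (rule linear_between_0[OF lin])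
    then have "f x = 0"
      by (simp only: x)
    then show ?case
      by simp
  next
    case (insert k S)
    have k: "x k \<noteq> 0"
      using insert.prems(1) by blast
    then have kI: "k \<in> I" "t \<in> bar B k"
      using insert.prems(2) by (auto simp: space_barsum)
    have supp: "{i. (x(k := 0)) i \<noteq> 0} = S"
      using insert.prems(1) insert.hyps(2) by (auto split: if_splits)
    then have mem: "x(k := 0) \<in> space_at (barsum I B) t"
      using insert.prems(2) insert.hyps(1) by (auto simp: space_barsum)
    have mem': "(\<lambda>i. x k * unit_vec k i) \<in> space_at (barsum I B) t"
      using kI by (auto simp: space_barsum unit_vec_def)
    have "x = x(k := 0) + (\<lambda>i. x k * unit_vec k i)"
      by (auto simp: fun_eq_iff unit_vec_def)
    then have "f x = f (x(k := 0) + (\<lambda>i. x k * unit_vec k i))"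
      by (rule arg_cong)
    also have "\<dots> = f (x(k := 0)) + f (\<lambda>i. x k * unit_vec k i)"
      using lin mem mem' unfolding linear_between_def by blast
    also have "f (\<lambda>i. x k * unit_vec k i) = (\<lambda>j. x k * f (unit_vec k) j)"
      using lin unit_vec_mem[of _ I _ B, OF kI] unfolding linear_between_def scl_barsum by blast
    finally have fx: "f x = f (x(k := 0)) + (\<lambda>j. x k * f (unit_vec k) j)" .
    have "f x j = f (x(k := 0)) j + x k * f (unit_vec k) j"
      using fun_cong[OF fx, of j] by (simp only: plus_fun_apply)
    also have "f (x(k := 0)) j = (\<Sum>i\<in>S. (x(k := 0)) i * f (unit_vec i) j)"
      using insert.IH[OF supp mem] .
    also have "\<dots> = (\<Sum>i\<in>S. x i * f (unit_vec i) j)"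
      using insert.hyps(2) by (intro sum.cong) auto
    finally show ?case
      using insert.hyps by (simp add: add.commute)
  qed
  then show ?thesis
    using x by (simp add: space_barsum)
qed

text \<open>Otherwise there is a point \<open>u\<close> from \<open>b\<close> on with
  \<open>u + e\<close> still before \<open>b'\<close>. It lies left of \<open>t\<close>, hence in
  the first interval, and contradicts \<open>closed\<close>.\<close>

lemma lower_endpoint_le:
  assumes t: "t \<in> interval b d" "t + e \<in> interval b' d'"
    and closed: "\<And>u. u \<le> t \<Longrightarrow> u \<in> interval b d \<Longrightarrow> u + e \<in> interval b' d'"
  shows "b' \<le> shift b e"
proof (rule ccontr)
  assume "\<not> b' \<le> shift b e"
  then have "b < shift b' (- e)"
    using shift_le_iff[of b' "- e" b] by simp
  then obtain u where u: "b \<le> Minus u" "Plus (u + e) \<le> b'"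
    using interval_nonempty_iff[of b "shift b' (- e)"] mem_interval_shift[of _ b 0 b' "- e"] by auto
  have "b' \<le> Minus (t + e)"
    using t(2) by (simp add: mem_interval)
  with u(2) have "Plus (u + e) \<le> Minus (t + e)"
    by (rule order_trans)
  then have "u < t" by simp
  then have "u \<in> interval b d"
    using u(1) t(1) order_trans[of "Plus u" "Plus t" d] by (simp add: mem_interval)
  then have "b' \<le> Minus (u + e)"
    using closed[of u] \<open>u < t\<close> by (simp add: mem_interval)
  then have "Plus (u + e) \<le> Minus (u + e)"
    using u(2) by (rule order_trans[rotated])
  then show False by simp
qed

text \<open>Mirror image, with \<open>closed\<close> reversed: what is still alive in the target at
  a later time must be alive in the source.\<close>

lemma upper_endpoint_le:
  assumes t: "t \<in> interval b d" "t + e \<in> interval b' d'"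
    and closed: "\<And>u. t \<le> u \<Longrightarrow> u + e \<in> interval b' d' \<Longrightarrow> u \<in> interval b d"
  shows "d' \<le> shift d e"
proof (rule ccontr)
  assume "\<not> d' \<le> shift d e"
  then have "d < shift d' (- e)"
    using shift_le_iff[of d' "- e" d] by simp
  then obtain u where u: "d \<le> Minus u" "Plus (u + e) \<le> d'"
    using interval_nonempty_iff[of d "shift d' (- e)"] mem_interval_shift[of _ d 0 d' "- e"] by auto
  have "Plus t \<le> d"
    using t(1) by (simp add: mem_interval)
  then have "Plus t \<le> Minus u"
    using u(1) by (rule order_trans)
  then have "t < u" by simp
  then have "u + e \<in> interval b' d'"
    using u(2) t(2) order_trans[of b' "Minus (t + e)" "Minus (u + e)"] by (simp add: mem_interval)
  then have "Plus u \<le> d"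
    using closed[of u] \<open>t < u\<close> by (simp add: mem_interval)
  then have "Plus u \<le> Minus u"
    using u(1) by (rule order_trans)
  then show False by simp
qed

text \<open>A map between two interval modules is a single scalar, because naturality makes the
  coefficient independent of time. The same naturality yields the endpoint inequalities:
  \<open>step\<close> the lower one, \<open>leave\<close> the upper one.\<close>

lemma morphism_matrix:
  fixes B :: "'i \<Rightarrow> decorated \<times> decorated" and C :: "'j \<Rightarrow> decorated \<times> decorated"
    and \<phi> :: "real \<Rightarrow> ('i \<Rightarrow> 'f::field) \<Rightarrow> 'j \<Rightarrow> 'f"
  assumes \<phi>: "morphism (barsum I B) (shift_module (barsum J C) e) \<phi>"
  obtains p where
    "\<And>i j t. i \<in> I \<Longrightarrow> t \<in> bar B i \<Longrightarrow>
      \<phi> t (unit_vec i) j = (if t + e \<in> bar C j then p i j else 0)"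
    "\<And>i j. p i j \<noteq> 0 \<Longrightarrow>
      j \<in> J \<and> fst (C j) \<le> shift (fst (B i)) e \<and> snd (C j) \<le> shift (snd (B i)) e"
proof -
  have supp: "j \<in> J \<and> t + e \<in> bar C j" if "i \<in> I" "t \<in> bar B i" "\<phi> t (unit_vec i) j \<noteq> 0" for i j t
    using morphismD(2)[OF \<phi> unit_vec_mem[of _ I _ B, OF that(1,2)]] that(3) by (simp add: space_barsum)
  have step: "\<phi> t (unit_vec i) j = (if j \<in> J \<and> s + e \<in> bar C j \<and> t + e \<in> bar C j then \<phi> s (unit_vec i) j else 0)"
    if i: "i \<in> I" and st: "s \<in> bar B i" "t \<in> bar B i" "s \<le> t" for i j s t
  proof -
    have "map_at (barsum I B) s t (unit_vec i :: 'i \<Rightarrow> 'f) = unit_vec i"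
      using i st by (auto simp: map_barsum unit_vec_def)
    then show ?thesis
      using morphismD(3)[OF \<phi> st(3) unit_vec_mem[of _ I _ B, OF i st(1)]] by (simp add: map_barsum)
  qed
  \<comment> \<open>Once \<open>t\<close> has left bar \<open>i\<close> the vector is 0, and so is
    its image, although the structure map of bar \<open>j\<close> would have kept the nonzero
    coefficient.\<close>
  have leave: "t \<in> bar B i"
    if i: "i \<in> I" and s: "s \<in> bar B i" "\<phi> s (unit_vec i) j \<noteq> 0" and st: "s \<le> t" "t + e \<in> bar C j" for i j s t
  proof (rule ccontr)
    assume "t \<notin> bar B i"
    then have "map_at (barsum I B) s t (unit_vec i :: 'i \<Rightarrow> 'f) = 0"
      by (auto simp: map_barsum unit_vec_def)
    moreover have "\<phi> t 0 = 0"
      by (rule linear_between_0[OF morphismD(1)[OF \<phi>]]) (simp add: space_barsum)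
    ultimately have "map_at (barsum J C) (s + e) (t + e) (\<phi> s (unit_vec i)) j = 0"
      using morphismD(3)[OF \<phi> st(1) unit_vec_mem[of _ I _ B, OF i s(1)]] by simp
    then show False
      using supp[OF i s] s st by (simp add: map_barsum)
  qed
  define P where "P = (\<lambda>i j t. i \<in> I \<and> t \<in> bar B i \<and> \<phi> t (unit_vec i) j \<noteq> 0)"
  \<comment> \<open>The value is taken at a time of nonzero coefficient if there is one, so
    \<open>p i j \<noteq> 0\<close> always comes with a time at which both bars are alive; the
    default 0 keeps the second conclusion true.\<close>
  define p where "p = (\<lambda>i j. if \<exists>t. P i j t then \<phi> (SOME t. P i j t) (unit_vec i) j else 0)"
  have p: "\<phi> t (unit_vec i) j = p i j" if t: "i \<in> I" "t \<in> bar B i" "t + e \<in> bar C j" for i j t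
  proof (cases "\<exists>t. P i j t")
    case True
    define s where "s = (SOME t. P i j t)"
    have "P i j s"
      unfolding s_def using True by (rule someI_ex)
    then have s: "s \<in> bar B i" "\<phi> s (unit_vec i) j \<noteq> 0" and "p i j = \<phi> s (unit_vec i) j"
      using True by (auto simp: P_def p_def s_def)
    with supp[OF t(1) s] t step[OF t(1) s(1) t(2), of j] step[OF t(1,2) s(1), of j] show ?thesis
      by (cases "s \<le> t") auto
  next
    case False
    with t show ?thesis by (auto simp: P_def p_def)
  qed
  show ?thesis
  proof (rule that[of p])
    show "\<phi> t (unit_vec i) j = (if t + e \<in> bar C j then p i j else 0)"
      if "i \<in> I" "t \<in> bar B i" for i j t
      using p[OF that, of j] supp[OF that, of j] by auto
    show "j \<in> J \<and> fst (C j) \<le> shift (fst (B i)) e \<and> snd (C j) \<le> shift (snd (B i)) e"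
      if nz: "p i j \<noteq> 0" for i j
    proof -
      obtain t where t: "i \<in> I" "t \<in> bar B i" "\<phi> t (unit_vec i) j \<noteq> 0"
        using nz by (auto simp: p_def P_def split: if_splits)
      have "u + e \<in> bar C j" if "u \<le> t" "u \<in> bar B i" for u
        using step[OF t(1) that(2) t(2) that(1), of j] t(3) by (auto split: if_splits)
      then have "fst (C j) \<le> shift (fst (B i)) e"
        using lower_endpoint_le[OF t(2)] supp[OF t] by blast
      moreover have "snd (C j) \<le> shift (snd (B i)) e"
        using upper_endpoint_le[OF t(2)] supp[OF t] leave[OF t] by blast
      ultimately show ?thesis
        using supp[OF t] by simp
    qed
  qed
qed

text \<open>The coefficient at \<open>i'\<close> of the image of \<open>unit_vec i\<close> under the
  composite is computed twice, by the interleaving identity at \<open>t\<close> and by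
  \<open>linear_expansion\<close>. The choice of \<open>t\<close> makes the structure map read off
  the identity matrix.\<close>

lemma matrix_product:
  fixes B :: "'i \<Rightarrow> decorated \<times> decorated" and C :: "'j \<Rightarrow> decorated \<times> decorated"
    and \<phi> :: "real \<Rightarrow> ('i \<Rightarrow> 'f::field) \<Rightarrow> 'j \<Rightarrow> 'f"
  assumes int: "interleaving e (barsum I B) (barsum J C) \<phi> \<psi>"
    and p: "\<And>i j t. i \<in> I \<Longrightarrow> t \<in> bar B i \<Longrightarrow>
      \<phi> t (unit_vec i) j = (if t + e \<in> bar C j then p i j else 0)"
    "\<And>i j. p i j \<noteq> 0 \<Longrightarrow>
      j \<in> J \<and> fst (C j) \<le> shift (fst (B i)) e \<and> snd (C j) \<le> shift (snd (B i)) e"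
    and q: "\<And>j i t. j \<in> J \<Longrightarrow> t \<in> bar C j \<Longrightarrow>
      \<psi> t (unit_vec j) i = (if t + e \<in> bar B i then q j i else 0)"
    "\<And>j i. q j i \<noteq> 0 \<Longrightarrow>
      i \<in> I \<and> fst (B i) \<le> shift (fst (C j)) e \<and> snd (B i) \<le> shift (snd (C j)) e"
    and i: "i \<in> I" "i' \<in> I" and t: "t \<in> bar B i" "t + 2 * e \<in> bar B i'"
    and K: "finite K" "{j. p i j \<noteq> 0 \<and> q j i' \<noteq> 0} \<subseteq> K"
  shows "(\<Sum>j\<in>K. p i j * q j i') = (if i = i' then 1 else 0)"
proof -
  have \<phi>: "morphism (barsum I B) (shift_module (barsum J C) e) \<phi>"
    and \<psi>: "morphism (barsum J C) (shift_module (barsum I B) e) \<psi>"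
    and \<psi>\<phi>: "\<And>x. x \<in> space_at (barsum I B) t \<Longrightarrow>
      \<psi> (t + e) (\<phi> t x) = map_at (barsum I B) t (t + 2 * e) x"
    using int by (auto simp: interleaving_def)
  define y where "y = \<phi> t (unit_vec i)"
  have y: "y \<in> space_at (barsum J C) (t + e)"
    using morphismD(2)[OF \<phi> unit_vec_mem[of _ I _ B, OF i(1) t(1)]] by (simp add: y_def)
  have "(if i = i' then 1 else 0) = map_at (barsum I B) t (t + 2 * e) (unit_vec i) i'"
    using i t by (auto simp: map_barsum unit_vec_def)
  also have "\<dots> = \<psi> (t + e) y i'"
    using \<psi>\<phi>[OF unit_vec_mem[of _ I _ B, OF i(1) t(1)]] by (simp add: y_def)
  also have "\<dots> = (\<Sum>j | y j \<noteq> 0. y j * \<psi> (t + e) (unit_vec j) i')"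
    by (rule linear_expansion[OF morphismD(1)[OF \<psi>, unfolded shift_module_simps] y])
  also have "\<dots> = (\<Sum>j | y j \<noteq> 0. p i j * q j i')"
  proof (rule sum.cong)
    fix j assume "j \<in> {j. y j \<noteq> 0}"
    then have j: "j \<in> J" "t + e \<in> bar C j"
      using y by (auto simp: space_barsum)
    then show "y j * \<psi> (t + e) (unit_vec j) i' = p i j * q j i'"
      using p(1)[OF i(1) t(1), of j] q(1)[OF j, of i'] t(2) by (simp add: y_def add.assoc)
  qed simp
  also have "\<dots> = (\<Sum>j\<in>K. p i j * q j i')"
  proof (rule sum.mono_neutral_cong)
    show "finite {j. y j \<noteq> 0}"
      using y by (simp add: space_barsum)
    show "p i j * q j i' = 0" if "j \<in> {j. y j \<noteq> 0} - K" for j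
      using that K(2) by auto
    \<comment> \<open>A nonzero product puts \<open>t + e\<close> into bar \<open>j\<close>:
      \<open>p i j\<close> controls the lower endpoint through \<open>t\<close>, and
      \<open>q j i'\<close> the upper one through \<open>t + 2 * e\<close>. Then
      \<open>y j = p i j\<close> would be nonzero.\<close>
    show "p i j * q j i' = 0" if j: "j \<in> K - {j. y j \<noteq> 0}" for j
    proof (rule ccontr)
      assume "p i j * q j i' \<noteq> 0"
      then have nz: "p i j \<noteq> 0" "q j i' \<noteq> 0" by auto
      have "fst (C j) \<le> Minus (t + e)"
        using p(2)[OF nz(1)] t(1) shift_le_iff[of "fst (C j)" "- e" "fst (B i)"]
          shift_le_iff[of "fst (C j)" "- e" "Minus t"]
        by (auto simp: mem_interval intro: order_trans)
      moreover have "Plus (t + e) \<le> snd (C j)"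
        using q(2)[OF nz(2)] t(2) shift_le_iff[of "Plus (t + 2 * e)" "- e" "snd (C j)"]
        by (auto simp: mem_interval add.commute intro: order_trans)
      ultimately have "t + e \<in> bar C j"
        by (simp add: mem_interval)
      then show False
        using p(1)[OF i(1) t(1), of j] nz(1) j by (simp add: y_def)
    qed
  qed (use K in simp_all)
  finally show ?thesis ..
qed

subsection \<open>From interleavings to matchings\<close>

text \<open>Endpoint form of the inclusions demanded of a matched pair in
  \<open>eps_matching\<close>.\<close>

definition close :: "real \<Rightarrow> decorated \<times> decorated \<Rightarrow> decorated \<times> decorated \<Rightarrow> bool" where
  "close e b c \<longleftrightarrow> fst b \<le> shift (fst c) e \<and> fst c \<le> shift (fst b) e \<and>
     snd b \<le> shift (snd c) e \<and> snd c \<le> shift (snd b) e"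

lemma close_sym: "close e b c \<longleftrightarrow> close e c b"
  by (auto simp: close_def)

text \<open>Twice the midpoint, in the ordered ring where unbounded bars have one too.\<close>

definition midpoint_key :: "decorated \<times> decorated \<Rightarrow> real poly" where
  "midpoint_key b = emb (fst b) + emb (snd b)"

lemma shift_less_iff_emb:
  assumes "0 \<le> e"
  shows "shift y e < x \<longleftrightarrow> emb y + [:0, e:] < emb x"
  using le_shift_iff_emb[OF assms, of x y] by (simp add: not_le[symmetric])

text \<open>In each of the steps from \<open>b\<close> to \<open>c\<close> and from \<open>c\<close>
  to \<open>b'\<close> no endpoint rises by more than \<open>e\<close>. If a step is not close, some
  endpoint falls by more than \<open>e\<close>, so the key strictly decreases; two such steps
  contradict the order of the keys.\<close>

lemma close_dichotomy:
  assumes "0 \<le> e"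
    and c: "fst c \<le> shift (fst b) e" "snd c \<le> shift (snd b) e"
    and b': "fst b' \<le> shift (fst c) e" "snd b' \<le> shift (snd c) e"
    and "midpoint_key b \<le> midpoint_key b'"
  shows "close e b c \<or> close e b' c"
proof -
  note [simp] = le_shift_iff_emb[OF assms(1)]
  show ?thesis
    using assms(2-6) unfolding close_def midpoint_key_def by (simp add: not_le) linarith
qed

text \<open>Supplies the time needed in \<open>matrix_product\<close>. If \<open>snd b'\<close> were
  at most \<open>fst b\<close> moved by \<open>2 * e\<close>, the lengths would force both endpoints
  of \<open>b'\<close> below those of \<open>b\<close>, against the keys. So some \<open>t\<close>
  lies between \<open>fst b\<close> and \<open>snd b'\<close> moved back by \<open>2 * e\<close>,
  and \<open>le\<close> gives the other two bounds.\<close>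

lemma midpoint_key_overlap:
  assumes "0 \<le> e"
    and long: "shift (fst b) (2 * e) < snd b" "shift (fst b') (2 * e) < snd b'"
    and le: "fst b' \<le> shift (fst b) (2 * e)" "snd b' \<le> shift (snd b) (2 * e)"
    and key: "midpoint_key b \<le> midpoint_key b'"
  obtains t where "t \<in> interval (fst b) (snd b)" "t + 2 * e \<in> interval (fst b') (snd b')"
proof -
  have e: "0 \<le> 2 * e"
    using assms(1) by simp
  have "shift (fst b) (2 * e) < snd b'"
    using long le(1) key
    unfolding midpoint_key_def le_shift_iff_emb[OF e] shift_less_iff_emb[OF e] by linarith
  then have "fst b < shift (snd b') (- 2 * e)"
    using shift_le_iff[of "snd b'" "- 2 * e" "fst b"] by (simp add: not_le[symmetric])
  then obtain t where t: "fst b \<le> Minus t" "Plus (t + 2 * e) \<le> snd b'"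
    using interval_nonempty_iff[of "fst b" "shift (snd b') (- 2 * e)"]
      mem_interval_shift[of _ "fst b" 0 "snd b'" "- 2 * e"] by auto
  have "Plus (t + 2 * e) \<le> shift (snd b) (2 * e)"
    using t(2) le(2) by (rule order_trans)
  then have "Plus t \<le> snd b"
    using shift_le_iff[of "Plus (t + 2 * e)" "- 2 * e" "snd b"] by simp
  moreover have "fst b' \<le> Minus (t + 2 * e)"
    using le(1) t(1) shift_le_iff[of "fst b'" "- 2 * e" "fst b"]
      shift_le_iff[of "fst b'" "- 2 * e" "Minus t"]
    by (auto intro: order_trans)
  ultimately show ?thesis
    using t that by (simp add: mem_interval)
qed

lemma long_bar:
  assumes "{a..a + 2 * e} \<subseteq> interval b d" and "0 \<le> e"
  shows "a \<in> interval b d" and "a + 2 * e \<in> interval b d" and "shift b (2 * e) < d"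
proof -
  show a: "a \<in> interval b d" "a + 2 * e \<in> interval b d"
    using assms by auto
  have "shift b (2 * e) \<le> Minus (a + 2 * e)"
    using a(1) shift_le_iff[of b "2 * e" "Minus (a + 2 * e)"] by (simp add: mem_interval)
  also have "\<dots> < Plus (a + 2 * e)"
    by (simp add: less_le_not_le)
  also have "\<dots> \<le> d"
    using a(2) by (simp add: mem_interval)
  finally show "shift b (2 * e) < d" .
qed

text \<open>All bars close to a long bar pass through the center of a closed interval of length
  \<open>2 * e\<close> in it, where local finiteness leaves only finitely many.\<close>

lemma close_mem:
  assumes "close e b c" and t: "t - e \<in> interval (fst b) (snd b)" "t + e \<in> interval (fst b) (snd b)"
  shows "t \<in> interval (fst c) (snd c)"
proof -
  have "fst c \<le> Minus t"
    using assms(1) t(1) shift_le_iff[of "fst c" "- e" "fst b"] shift_le_iff[of "fst c" "- e" "Minus (t - e)"]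
    by (auto simp: close_def mem_interval intro: order_trans)
  moreover have "Plus t \<le> snd c"
    using assms(1) t(2) shift_le_iff[of "Plus (t + e)" "- e" "snd c"]
    by (auto simp: close_def mem_interval intro: order_trans)
  ultimately show ?thesis
    by (simp add: mem_interval)
qed

text \<open>Hall's inequality is \<open>card_le_triangular\<close> for the coefficient matrices,
  with the close bars as \<open>K\<close> and \<open>midpoint_key\<close> as the order.\<close>

lemma hall_family_close:
  fixes B :: "'i \<Rightarrow> decorated \<times> decorated" and C :: "'j \<Rightarrow> decorated \<times> decorated"
    and \<phi> :: "real \<Rightarrow> ('i \<Rightarrow> 'f::field) \<Rightarrow> 'j \<Rightarrow> 'f"
  assumes int: "interleaving e (barsum I B) (barsum J C) \<phi> \<psi>" and e: "0 \<le> e"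
    and lf: "locally_finite J C"
  shows "hall_family {i\<in>I. \<exists>a. {a..a + 2 * e} \<subseteq> bar B i} (\<lambda>i. {j\<in>J. close e (B i) (C j)})"
    (is "hall_family ?L ?N")
proof -
  have fin: "finite (?N i)" if i: "i \<in> ?L" for i
  proof -
    obtain a where a: "{a..a + 2 * e} \<subseteq> bar B i"
      using i by blast
    note a = long_bar[OF a e]
    obtain U where "a + e \<in> U" "finite {j\<in>J. bar C j \<inter> U \<noteq> {}}"
      using lf unfolding locally_finite_def by blast
    moreover have "a + e \<in> bar C j" if "close e (B i) (C j)" for j
      using close_mem[OF that, of "a + e"] a by (simp add: add.assoc)
    ultimately show ?thesis
      by (auto intro: finite_subset[rotated])
  qed
  obtain p where p: "\<And>i j t. i \<in> I \<Longrightarrow> t \<in> bar B i \<Longrightarrow>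
      \<phi> t (unit_vec i) j = (if t + e \<in> bar C j then p i j else 0)"
    "\<And>i j. p i j \<noteq> 0 \<Longrightarrow>
      j \<in> J \<and> fst (C j) \<le> shift (fst (B i)) e \<and> snd (C j) \<le> shift (snd (B i)) e"
    using int morphism_matrix[of I B J C e \<phi>] unfolding interleaving_def by auto
  obtain q where q: "\<And>j i t. j \<in> J \<Longrightarrow> t \<in> bar C j \<Longrightarrow>
      \<psi> t (unit_vec j) i = (if t + e \<in> bar B i then q j i else 0)"
    "\<And>j i. q j i \<noteq> 0 \<Longrightarrow>
      i \<in> I \<and> fst (B i) \<le> shift (fst (C j)) e \<and> snd (B i) \<le> shift (snd (C j)) e"
    using int morphism_matrix[of J C I B e \<psi>] unfolding interleaving_def by auto
  have "card A \<le> card (\<Union>i\<in>A. ?N i)" if A: "finite A" "A \<subseteq> ?L" for A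
  proof (rule card_le_triangular)
    let ?K = "\<Union>i\<in>A. ?N i"
    show K: "finite ?K"
      using A fin by blast
    show "(\<Sum>j\<in>?K. p i j * q j i') = (if i = i' then 1 else 0)"
      if i: "i \<in> A" "i' \<in> A" and key: "midpoint_key (B i) \<le> midpoint_key (B i')" for i i'
    \<comment> \<open>\<open>matrix_product\<close> requires a time \<open>t\<close> in bar
      \<open>i\<close> with \<open>t + 2 * e\<close> in bar \<open>i'\<close>. It exists if the bars
      coincide or some \<open>j\<close> connects them; otherwise every product is 0.\<close>
    proof (cases "i = i' \<or> (\<exists>j. p i j \<noteq> 0 \<and> q j i' \<noteq> 0)")
      case False
      then have "(\<Sum>j\<in>?K. p i j * q j i') = 0"
        by (intro sum.neutral) auto
      then show ?thesis
        using False by simp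
    next
      case True
      obtain a a' where a: "{a..a + 2 * e} \<subseteq> bar B i" "{a'..a' + 2 * e} \<subseteq> bar B i'"
        using i A by blast
      \<comment> \<open>By the dichotomy, bars outside \<open>?K\<close> contribute nothing, so the
        full matrix product is already computed over \<open>?K\<close>.\<close>
      have "{j. p i j \<noteq> 0 \<and> q j i' \<noteq> 0} \<subseteq> ?K"
      proof
        fix j assume "j \<in> {j. p i j \<noteq> 0 \<and> q j i' \<noteq> 0}"
        then have nz: "p i j \<noteq> 0" "q j i' \<noteq> 0" by auto
        then have "close e (B i) (C j) \<or> close e (B i') (C j)"
          using p(2)[OF nz(1)] q(2)[OF nz(2)] key e by (intro close_dichotomy) auto
        then show "j \<in> ?K"
          using i p(2)[OF nz(1)] by blast
      qed
      moreover have "\<exists>t. t \<in> bar B i \<and> t + 2 * e \<in> bar B i'"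
        using True
      proof
        assume "i = i'"
        then show ?thesis using long_bar[OF a(1) e] by blast
      next
        assume "\<exists>j. p i j \<noteq> 0 \<and> q j i' \<noteq> 0"
        then obtain j where j: "p i j \<noteq> 0" "q j i' \<noteq> 0" by blast
        have trans: "x \<le> shift z (2 * e)" if "x \<le> shift y e" "y \<le> shift z e" for x y z
          using that order_trans[of x "shift y e" "shift z (2 * e)"] shift_le_shift[of y e "shift z e"]
          by simp
        show ?thesis
          by (rule midpoint_key_overlap[OF e long_bar(3)[OF a(1) e] long_bar(3)[OF a(2) e]
                trans trans key])
            (use p(2)[OF j(1)] q(2)[OF j(2)] in auto)
      qed
      ultimately show ?thesis
        using matrix_product[OF int p q _ _ _ _ K] i A by blast
    qed
  qed (use A in simp)
  then show ?thesis
    using fin by (simp add: hall_family_def)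
qed

lemma close_imp_subset:
  assumes "close e b c"
  shows "interval (fst b) (snd b) \<subseteq> interval (shift (fst c) (- e)) (shift (snd c) e)"
proof -
  have "shift (fst c) (- e) \<le> fst b" "snd b \<le> shift (snd c) e"
    using assms shift_le_iff[of "fst c" "- e" "fst b"] by (auto simp: close_def)
  then show ?thesis
    by (auto simp: mem_interval intro: order_trans)
qed

text \<open>\<open>close\<close> is symmetric, so the injections of the long bars from both sides
  select pairs of one relation and can be merged.\<close>

lemma interleaving_imp_eps_matching:
  fixes B :: "'i \<Rightarrow> decorated \<times> decorated" and C :: "'j \<Rightarrow> decorated \<times> decorated"
    and \<phi> :: "real \<Rightarrow> ('i \<Rightarrow> 'f::field) \<Rightarrow> 'j \<Rightarrow> 'f"
  assumes int: "interleaving e (barsum I B) (barsum J C) \<phi> \<psi>" and e: "0 \<le> e"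
    and lf: "locally_finite I B" "locally_finite J C"
  shows "\<exists>M. eps_matching e I B J C M"
proof -
  let ?L = "{i\<in>I. \<exists>a. {a..a + 2 * e} \<subseteq> bar B i}" and ?L' = "{j\<in>J. \<exists>a. {a..a + 2 * e} \<subseteq> bar C j}"
  obtain f where f: "inj_on f ?L" "\<And>i. i \<in> ?L \<Longrightarrow> f i \<in> {j\<in>J. close e (B i) (C j)}"
    using hall_infinite[OF hall_family_close[OF int e lf(2)]] by blast
  obtain g where g: "inj_on g ?L'" "\<And>j. j \<in> ?L' \<Longrightarrow> g j \<in> {i\<in>I. close e (C j) (B i)}"
    using hall_infinite[OF hall_family_close[OF interleaving_sym[OF int] e lf(1)]] by blast
  have "\<exists>M. matching I J M \<and> (\<forall>i\<in>?L. \<exists>j. (i, j) \<in> M) \<and> (\<forall>j\<in>?L'. \<exists>i. (i, j) \<in> M) \<and>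
      (\<forall>(i, j)\<in>M. close e (B i) (C j))"
    by (rule combine_matchings[where f = f and g = g])
      (use f g close_sym in blast)+
  then obtain M where M: "matching I J M" "\<forall>i\<in>?L. \<exists>j. (i, j) \<in> M" "\<forall>j\<in>?L'. \<exists>i. (i, j) \<in> M"
      "\<And>i j. (i, j) \<in> M \<Longrightarrow> close e (B i) (C j)"
    by blast
  have "eps_matching e I B J C M"
    unfolding eps_matching_def
  proof (intro conjI)
    show "\<forall>(i, j)\<in>M. bar B i \<subseteq> interval (shift (fst (C j)) (- e)) (shift (snd (C j)) e) \<and>
        bar C j \<subseteq> interval (shift (fst (B i)) (- e)) (shift (snd (B i)) e)"
      using close_imp_subset[OF M(4)] close_imp_subset[OF iffD1[OF close_sym M(4)]] by blast
  qed (use M(1-3) in simp_all)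
  then show ?thesis ..
qed

section \<open>Algebraic stability and its converse for locally finite modules\<close>

theorem theorem6p1:
  fixes U :: "('f::field, 'u::ab_group_add) pmodule"
    and V :: "('f, 'v::ab_group_add) pmodule"
    and I :: "'i set" and B :: "'i \<Rightarrow> decorated \<times> decorated"
    and J :: "'j set" and C :: "'j \<Rightarrow> decorated \<times> decorated"
  assumes "persistence_module U" and "is_barcode I B U" and "locally_finite I B"
    and "persistence_module V" and "is_barcode J C V" and "locally_finite J C"
  shows "(\<forall>\<epsilon>\<ge>0. (\<exists>\<phi> \<psi>. interleaving \<epsilon> U V \<phi> \<psi>) \<longleftrightarrow> (\<exists>M. eps_matching \<epsilon> I B J C M)) \<and>
    interleaving_distance U V = bottleneck_distance I B J C"
proof -
  have iso: "isomorphic U (barsum I B)" "isomorphic V (barsum J C)"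
    using assms(2,5) by (simp_all add: is_barcode_def)
  have iff: "(\<exists>\<phi> \<psi>. interleaving \<epsilon> U V \<phi> \<psi>) \<longleftrightarrow> (\<exists>M. eps_matching \<epsilon> I B J C M)" if "0 \<le> \<epsilon>" for \<epsilon>
  proof
    assume "\<exists>\<phi> \<psi>. interleaving \<epsilon> U V \<phi> \<psi>"
    then obtain \<phi> \<psi> where "interleaving \<epsilon> U V \<phi> \<psi>" by blast
    from interleaving_transfer[OF this that iso persistence_module_barsum persistence_module_barsum]
    obtain \<phi>' \<psi>' where "interleaving \<epsilon> (barsum I B :: ('f, 'i \<Rightarrow> 'f) pmodule) (barsum J C) \<phi>' \<psi>'"
      by blast
    then show "\<exists>M. eps_matching \<epsilon> I B J C M"
      using that assms(3,6) by (rule interleaving_imp_eps_matching)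
  next
    assume "\<exists>M. eps_matching \<epsilon> I B J C M"
    then obtain M where "eps_matching \<epsilon> I B J C M" by blast
    \<comment> \<open>A matching does not mention a field, so the coefficients of the constructed
      interleaving are fixed to \<open>'f\<close> here.\<close>
    from interleaving_transport[OF this that, where 'f = 'f] that
      isomorphic_sym[OF iso(1)] isomorphic_sym[OF iso(2)] assms(1,4)
    show "\<exists>\<phi> \<psi>. interleaving \<epsilon> U V \<phi> \<psi>"
      by (rule interleaving_transfer)
  qed
  moreover have "interleaving_distance U V = bottleneck_distance I B J C"
  proof -
    have "0 < \<epsilon> \<and> (\<exists>\<phi> \<psi>. interleaving \<epsilon> U V \<phi> \<psi>) \<longleftrightarrow> 0 < \<epsilon> \<and> (\<exists>M. eps_matching \<epsilon> I B J C M)" for \<epsilon>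
      by (cases "0 < \<epsilon>") (simp_all add: iff)
    then show ?thesis
      unfolding interleaving_distance_def bottleneck_distance_def by (simp only:)
  qed
  ultimately show ?thesis by blast
qed

end
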